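(* Let $A$ be a Hausdorff abelian topological group such that $\alpha_A$ is injective, and let $K\le A$ be a compact subgroup. Then: (a) $\alpha_{A/K}$ is injective; (b) $\alpha_{A/K}$ is surjective if and only if $\alpha_A$ is surjective; (c) $\alpha_{A/K}$ is an isomorphism of topological groups if and only if $\alpha_A$ is.
   Context: $\mathbb{T}=\mathbb{R}/\mathbb{Z}$. For an abelian topological group $B$, $\hat B$ is the group of continuous homomorphisms $B\to\mathbb{T}$ with the compact-open topology, and $\alpha_B\colon B\to\hat{\hat B}$ is the evaluation homomorphism $\alpha_B(b)(\chi)=\chi(b)$. $A/K$ carries the quotient topology. *)

theory Defs
  imports "HOL-Analysis.Analysis" "HOL-Algebra.Algebra"
begin

definition abelian_topological_group :: "'a monoid \<Rightarrow> 'a topology \<Rightarrow> bool" where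
  "abelian_topological_group G T \<longleftrightarrow>
     comm_group G \<and> topspace T = carrier G \<and>
     continuous_map (prod_topology T T) T (\<lambda>(x, y). x \<otimes>\<^bsub>G\<^esub> y) \<and>
     continuous_map T T (m_inv G)"

text \<open>The circle group \<open>\<bbbT> = \<real>/\<int>\<close>, realised (via \<open>t \<mapsto> exp(2\<pi>it)\<close>) as the unit circle in \<open>\<complex>\<close>.\<close>
definition circle_group :: "complex monoid" where
  "circle_group = \<lparr>carrier = sphere 0 1, mult = (*), one = 1\<rparr>"

definition circle_top :: "complex topology" where
  "circle_top = top_of_set (sphere 0 1)"

definition characters :: "'a monoid \<Rightarrow> 'a topology \<Rightarrow> ('a \<Rightarrow> complex) set" where
  "characters G T = {ch. ch \<in> extensional (carrier G) \<and> ch \<in> hom G circle_group \<and>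
                        continuous_map T circle_top ch}"

definition dual_group :: "'a monoid \<Rightarrow> 'a topology \<Rightarrow> ('a \<Rightarrow> complex) monoid" where
  "dual_group G T = \<lparr>carrier = characters G T,
                      mult = (\<lambda>ch ps. \<lambda>x\<in>carrier G. ch x * ps x),
                      one = (\<lambda>x\<in>carrier G. 1)\<rparr>"

definition dual_top :: "'a monoid \<Rightarrow> 'a topology \<Rightarrow> ('a \<Rightarrow> complex) topology" where
  "dual_top G T = topology_generated_by
      {{ch \<in> characters G T. ch ` C \<subseteq> U} | C U. compactin T C \<and> openin circle_top U}"

abbreviation bidual_group :: "'a monoid \<Rightarrow> 'a topology \<Rightarrow> (('a \<Rightarrow> complex) \<Rightarrow> complex) monoid" where
  "bidual_group G T \<equiv> dual_group (dual_group G T) (dual_top G T)"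

abbreviation bidual_top :: "'a monoid \<Rightarrow> 'a topology \<Rightarrow> (('a \<Rightarrow> complex) \<Rightarrow> complex) topology" where
  "bidual_top G T \<equiv> dual_top (dual_group G T) (dual_top G T)"

definition eval_map :: "'a monoid \<Rightarrow> 'a topology \<Rightarrow> 'a \<Rightarrow> (('a \<Rightarrow> complex) \<Rightarrow> complex)" where
  "eval_map G T a = (\<lambda>ch\<in>characters G T. ch a)"

definition quot_top :: "'a monoid \<Rightarrow> 'a topology \<Rightarrow> 'a set \<Rightarrow> 'a set topology" where
  "quot_top G T K = topology (\<lambda>U. U \<subseteq> carrier (G Mod K) \<and>
      openin T {x \<in> topspace T. K #>\<^bsub>G\<^esub> x \<in> U})"

definition top_group_iso :: "'a monoid \<Rightarrow> 'a topology \<Rightarrow> 'b monoid \<Rightarrow> 'b topology \<Rightarrow> ('a \<Rightarrow> 'b) \<Rightarrow> bool" where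
  "top_group_iso G T H S f \<longleftrightarrow> f \<in> iso G H \<and> homeomorphic_map T S f"

end

theory Submission
  imports Defs
begin

text \<open>
  Write \<open>A^\<close> for the dual of \<open>A\<close>. The engine is a double annihilator theorem: if \<open>H\<close> is a compact group
  (for pointwise convergence) of homomorphisms from an abelian group \<open>D\<close> to the circle, then a
  homomorphism killing everything that \<open>H\<close> kills belongs to \<open>H\<close>. Otherwise Stone--Weierstrass separates
  \<open>H\<close> from its translate \<open>b H\<close> by a trigonometric polynomial, and averaging over \<open>H\<close> contradicts this.
  Applied to the evaluations at points of \<open>K\<close>, it shows that every homomorphism on \<open>A^\<close> that is trivial
  on the annihilator of \<open>K\<close> is evaluation at a point of \<open>K\<close>; this yields (a).

  Since \<open>K\<close> is compact and the circle has no small subgroups, \<open>(A/K)^\<close> is, as a topological group, the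
  annihilator of \<open>K\<close>, an open subgroup of \<open>A^\<close>. By the same theorem homomorphisms extend from it to
  \<open>A^\<close>, and the extensions are continuous by openness; this yields (b). A compact subset of \<open>A^\<close> meets
  only finitely many cosets of the annihilator, so uniform closeness on it amounts to uniform
  closeness on a compact subset of the annihilator together with closeness at finitely many
  characters. The latter is adjusted by an element of \<open>K\<close>, which yields (c).
\<close>

section \<open>Compact groups of homomorphisms to the circle\<close>

text \<open>No Haar measure enters: the average over a compact group of homomorphisms is taken one
  element at a time, by Cesaro means of its powers. This suffices because a trigonometric polynomial
  has finitely many terms. The double annihilator theorem sees the dual as a discrete group and asks
  no continuity of the homomorphisms on it. So the group of all of them is compact by Tychonoff,
  which is what makes finitary versions available. Continuity is recovered only afterwards: either
  the homomorphism turns out to be an evaluation, or it agrees with a continuous one on an open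
  subgroup. Nothing in (b) provides continuity or openness of \<open>eval_map\<close>. For (c) both
  are therefore rewritten at the identity, as statements about compact sets of characters, and
  transferred separately. Openness is the delicate half: passing between A and A/K leaves an error
  in K, which finitely many characters have to control.\<close>

lemma open_coordinate_vimage:
  fixes U :: "'b::topological_space set"
  assumes "open U"
  shows "open {h :: 'a \<Rightarrow> 'b. h i \<in> U}"
proof -
  have "open ((\<lambda>h :: 'a \<Rightarrow> 'b. h i) -` U)"
    by (intro open_vimage assms continuous_on_product_coordinates)
  then show ?thesis by (simp add: vimage_def)
qed

lemma continuous_on_coordinate:
  "continuous_on S (\<lambda>h :: 'a \<Rightarrow> 'b::topological_space. h i)"
  by (rule continuous_on_subset[OF continuous_on_product_coordinates]) simp

section \<open>Separation axioms for pointwise convergence\<close>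

text \<open>The Stone-Weierstrass locale \<open>function_ring_on\<close> lives on a
  \<open>t2_space\<close>. Function types into a Hausdorff type qualify, since two different
  functions are separated by one coordinate.\<close>

instance "fun" :: (type, t0_space) t0_space
proof
  fix f g :: "'a \<Rightarrow> 'b" assume "f \<noteq> g"
  then obtain i where "f i \<noteq> g i" by blast
  obtain U where "open U" "\<not> (f i \<in> U \<longleftrightarrow> g i \<in> U)"
    using t0_space_class.t0_space[OF \<open>f i \<noteq> g i\<close>] by blast
  then show "\<exists>U. open U \<and> \<not> (f \<in> U \<longleftrightarrow> g \<in> U)"
    using open_coordinate_vimage[of U i] by (intro exI[of _ "{h. h i \<in> U}"]) auto
qed

instance "fun" :: (type, t1_space) t1_space
proof
  fix f g :: "'a \<Rightarrow> 'b" assume "f \<noteq> g"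
  then obtain i where "f i \<noteq> g i" by blast
  obtain U where "open U" "f i \<in> U" "g i \<notin> U"
    using t1_space[OF \<open>f i \<noteq> g i\<close>] by blast
  then show "\<exists>U. open U \<and> f \<in> U \<and> g \<notin> U"
    using open_coordinate_vimage[of U i] by (intro exI[of _ "{h. h i \<in> U}"]) auto
qed

instance "fun" :: (type, t2_space) t2_space
proof
  fix f g :: "'a \<Rightarrow> 'b" assume "f \<noteq> g"
  then obtain i where "f i \<noteq> g i" by blast
  obtain U V where "open U" "open V" "f i \<in> U" "g i \<in> V" "U \<inter> V = {}"
    using hausdorff[OF \<open>f i \<noteq> g i\<close>] by blast
  then show "\<exists>U V. open U \<and> open V \<and> f \<in> U \<and> g \<in> V \<and> U \<inter> V = {}"
    using open_coordinate_vimage[of U i] open_coordinate_vimage[of V i]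
    by (intro exI[of _ "{h. h i \<in> U}"] exI[of _ "{h. h i \<in> V}"]) auto
qed

section \<open>Homomorphisms to the circle, without continuity\<close>

text \<open>The Pontryagin dual of \<open>D\<close> taken as a discrete group; its topology is
  pointwise convergence, inherited from the function type. Fixing the values off the carrier by
  \<open>extensional\<close> is what allows the set to be compact.\<close>

definition alg_characters :: "'i monoid \<Rightarrow> ('i \<Rightarrow> complex) set" where
  "alg_characters D = {h. h \<in> extensional (carrier D) \<and> h \<in> hom D circle_group}"

lemma alg_characters_iff:
  "h \<in> alg_characters D \<longleftrightarrow> h \<in> extensional (carrier D) \<and> (\<forall>x\<in>carrier D. norm (h x) = 1) \<and>
     (\<forall>x\<in>carrier D. \<forall>y\<in>carrier D. h (x \<otimes>\<^bsub>D\<^esub> y) = h x * h y)"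
  by (auto simp: alg_characters_def hom_def circle_group_def Pi_iff)

lemma alg_characters_norm: "h \<in> alg_characters D \<Longrightarrow> x \<in> carrier D \<Longrightarrow> norm (h x) = 1"
  and alg_characters_mult: "h \<in> alg_characters D \<Longrightarrow> x \<in> carrier D \<Longrightarrow> y \<in> carrier D \<Longrightarrow>
    h (x \<otimes>\<^bsub>D\<^esub> y) = h x * h y"
  by (auto simp: alg_characters_iff)

lemma alg_characters_one:
  assumes "group D" "h \<in> alg_characters D"
  shows "h \<one>\<^bsub>D\<^esub> = 1"
proof -
  interpret group D by fact
  have "h \<one>\<^bsub>D\<^esub> * h \<one>\<^bsub>D\<^esub> = h \<one>\<^bsub>D\<^esub>"
    using alg_characters_mult[OF assms(2), of "\<one>\<^bsub>D\<^esub>" "\<one>\<^bsub>D\<^esub>"] by simp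
  moreover have "h \<one>\<^bsub>D\<^esub> \<noteq> 0"
    using alg_characters_norm[OF assms(2), of "\<one>\<^bsub>D\<^esub>"] by auto
  ultimately show ?thesis by simp
qed

lemma alg_characters_inv:
  assumes "group D" "h \<in> alg_characters D" "x \<in> carrier D"
  shows "h (inv\<^bsub>D\<^esub> x) = cnj (h x)"
proof -
  interpret group D by fact
  have "h (inv\<^bsub>D\<^esub> x) * h x = 1"
    using alg_characters_mult[OF assms(2), of "inv\<^bsub>D\<^esub> x" x] assms
    by (simp add: alg_characters_one)
  moreover have "cnj (h x) * h x = 1"
    using alg_characters_norm[OF assms(2,3)]
    by (metis complex_cnj_one complex_cnj_mult complex_norm_square mult.commute of_real_1 power_one)
  moreover have "h x \<noteq> 0"
    using alg_characters_norm[OF assms(2,3)] by auto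
  ultimately show ?thesis by (metis mult_right_cancel)
qed

lemma compact_alg_characters: "compact (alg_characters D)"
proof -
  \<comment> \<open>Off the carrier the factor is a single point: this encodes
    \<open>extensional\<close> and leaves the product compact by Tychonoff.\<close>
  let ?S = "\<lambda>i. if i \<in> carrier D then sphere 0 1 else {undefined :: complex}"
  have "compactin (product_topology (\<lambda>i. euclidean) UNIV) (PiE UNIV ?S)"
    by (subst compactin_PiE) auto
  then have *: "compact (PiE UNIV ?S)"
    by (metis compactin_euclidean_iff euclidean_product_topology)
  have "closed {h :: 'a \<Rightarrow> complex. \<forall>x y. x \<in> carrier D \<longrightarrow> y \<in> carrier D \<longrightarrow> h (x \<otimes>\<^bsub>D\<^esub> y) = h x * h y}"
    by (intro closed_Collect_all closed_Collect_imp closed_Collect_eq continuous_intros continuous_on_coordinate open_Collect_const)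
  then have "compact (PiE UNIV ?S \<inter> {h. \<forall>x y. x \<in> carrier D \<longrightarrow> y \<in> carrier D \<longrightarrow> h (x \<otimes>\<^bsub>D\<^esub> y) = h x * h y})"
    using * by (rule compact_Int_closed[rotated])
  moreover have "alg_characters D = PiE UNIV ?S \<inter>
      {h. \<forall>x y. x \<in> carrier D \<longrightarrow> y \<in> carrier D \<longrightarrow> h (x \<otimes>\<^bsub>D\<^esub> y) = h x * h y}"
    by (auto simp: alg_characters_iff extensional_def PiE_def Pi_iff split: if_splits)
  ultimately show ?thesis by simp
qed

section \<open>Trigonometric polynomials\<close>

text \<open>A trigonometric polynomial as a list of coefficient-frequency pairs. Lists admit
  repeated frequencies, so that sums are just \<open>@\<close>, and their length is the induction
  measure in \<open>trig_no_separation\<close>.\<close>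

definition trig_eval :: "(complex \<times> 'i) list \<Rightarrow> ('i \<Rightarrow> complex) \<Rightarrow> complex" where
  "trig_eval l h = (\<Sum>(c, x)\<leftarrow>l. c * h x)"

lemma trig_eval_simps [simp]:
  "trig_eval [] h = 0"
  "trig_eval (p # l) h = fst p * h (snd p) + trig_eval l h"
  "trig_eval (l @ l') h = trig_eval l h + trig_eval l' h"
  by (auto simp: trig_eval_def case_prod_beta)

lemma trig_eval_cong: "(\<And>x. x \<in> snd ` set l \<Longrightarrow> h x = h' x) \<Longrightarrow> trig_eval l h = trig_eval l h'"
  by (induction l) auto

lemma trig_eval_scale:
  assumes "snd ` set l \<subseteq> carrier D" "x \<in> carrier D" "group D"
  shows "\<exists>l'. snd ` set l' \<subseteq> carrier D \<and>
     (\<forall>h\<in>alg_characters D. trig_eval l' h = c * h x * trig_eval l h)"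
proof -
  interpret group D by fact
  have "trig_eval (map (\<lambda>(d, y). (c * d, x \<otimes>\<^bsub>D\<^esub> y)) l) h = c * h x * trig_eval l h"
    if "h \<in> alg_characters D" for h
    using assms(1) by (induction l) (auto simp: alg_characters_mult that assms algebra_simps)
  moreover have "snd ` set (map (\<lambda>(d, y). (c * d, x \<otimes>\<^bsub>D\<^esub> y)) l) \<subseteq> carrier D"
    using assms by auto
  ultimately show ?thesis by blast
qed

lemma trig_eval_times:
  assumes "snd ` set l \<subseteq> carrier D" "snd ` set m \<subseteq> carrier D" "group D"
  shows "\<exists>l'. snd ` set l' \<subseteq> carrier D \<and>
     (\<forall>h\<in>alg_characters D. trig_eval l' h = trig_eval l h * trig_eval m h)"
  using assms(1)
proof (induction l)
  case Nil
  then show ?case by (intro exI[of _ "[]"]) auto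
next
  case (Cons p l)
  then obtain l1 where l1: "snd ` set l1 \<subseteq> carrier D"
    "\<forall>h\<in>alg_characters D. trig_eval l1 h = trig_eval l h * trig_eval m h" by auto
  obtain l2 where l2: "snd ` set l2 \<subseteq> carrier D"
    "\<forall>h\<in>alg_characters D. trig_eval l2 h = fst p * h (snd p) * trig_eval m h"
    using trig_eval_scale[OF assms(2) _ assms(3), of "snd p" "fst p"] Cons.prems by auto
  show ?case
    using l1 l2 by (intro exI[of _ "l2 @ l1"]) (auto simp: algebra_simps)
qed

lemma trig_eval_cnj:
  assumes "snd ` set l \<subseteq> carrier D" "group D"
  shows "\<exists>l'. snd ` set l' \<subseteq> carrier D \<and>
     (\<forall>h\<in>alg_characters D. trig_eval l' h = cnj (trig_eval l h))"
proof -
  interpret group D by fact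
  have "trig_eval (map (\<lambda>(d, y). (cnj d, inv\<^bsub>D\<^esub> y)) l) h = cnj (trig_eval l h)"
    if "h \<in> alg_characters D" for h
    using assms(1) by (induction l) (auto simp: alg_characters_inv that assms algebra_simps)
  moreover have "snd ` set (map (\<lambda>(d, y). (cnj d, inv\<^bsub>D\<^esub> y)) l) \<subseteq> carrier D"
    using assms by auto
  ultimately show ?thesis by blast
qed

lemma continuous_on_trig_eval: "continuous_on S (trig_eval l)"
proof (induction l)
  case (Cons p l)
  have "continuous_on S (\<lambda>h. fst p * h (snd p) + trig_eval l h)"
    by (intro continuous_intros continuous_on_coordinate Cons)
  then show ?case by (simp add: fun_eq_iff cong: continuous_on_cong)
qed (simp add: trig_eval_def)

text \<open>Stone-Weierstrass in its two-set form with tolerance 1/3, for the real parts of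
  trigonometric polynomials. That they are closed under products rests on Re p * Re q = Re (p * (q +
  cnj q) / 2), where conjugation inverts the frequencies.\<close>

lemma trig_separation:
  fixes D :: "'i monoid"
  assumes D: "group D" and A: "compact A" "A \<subseteq> alg_characters D"
    and B: "compact B" "B \<subseteq> alg_characters D" and "A \<inter> B = {}"
  shows "\<exists>l. snd ` set l \<subseteq> carrier D \<and> (\<forall>h\<in>A. Re (trig_eval l h) \<le> 1/3) \<and>
    (\<forall>h\<in>B. Re (trig_eval l h) \<ge> 2/3)"
proof -
  interpret group D by fact
  define R where "R = {f. \<exists>l. snd ` set l \<subseteq> carrier D \<and> (\<forall>h\<in>alg_characters D. f h = Re (trig_eval l h))}"
  have RI: "f \<in> R" if "snd ` set l \<subseteq> carrier D" "\<And>h. h \<in> alg_characters D \<Longrightarrow> f h = Re (trig_eval l h)" for f l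
    using that unfolding R_def by blast
  have RE: "\<exists>l. snd ` set l \<subseteq> carrier D \<and> (\<forall>h\<in>alg_characters D. f h = Re (trig_eval l h))" if "f \<in> R" for f
    using that unfolding R_def by blast
  have sub: "A \<union> B \<subseteq> alg_characters D" using A B by simp
  interpret function_ring_on R "A \<union> B"
  proof
    show "compact (A \<union> B)" using A B by auto
    show "continuous_on (A \<union> B) f" if "f \<in> R" for f
    proof -
      obtain l where l: "\<forall>h\<in>alg_characters D. f h = Re (trig_eval l h)" using RE[OF \<open>f \<in> R\<close>] by blast
      have "continuous_on (A \<union> B) (\<lambda>h. Re (trig_eval l h))"
        by (intro continuous_intros continuous_on_trig_eval)
      then show ?thesis
        using l sub by (subst continuous_on_cong[OF refl, of _ _ "\<lambda>h. Re (trig_eval l h)"]) auto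
    qed
    show "(\<lambda>x. f x + g x) \<in> R" if fg: "f \<in> R" "g \<in> R" for f g
    proof -
      obtain l m where "snd ` set l \<subseteq> carrier D" "\<forall>h\<in>alg_characters D. f h = Re (trig_eval l h)"
        "snd ` set m \<subseteq> carrier D" "\<forall>h\<in>alg_characters D. g h = Re (trig_eval m h)"
        using RE[OF fg(1)] RE[OF fg(2)] by blast
      then show ?thesis by (intro RI[of "l @ m"]) auto
    qed
    show "(\<lambda>x. f x * g x) \<in> R" if fg: "f \<in> R" "g \<in> R" for f g
    proof -
      obtain l m where l: "snd ` set l \<subseteq> carrier D" "\<forall>h\<in>alg_characters D. f h = Re (trig_eval l h)"
        and m: "snd ` set m \<subseteq> carrier D" "\<forall>h\<in>alg_characters D. g h = Re (trig_eval m h)"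
        using RE[OF fg(1)] RE[OF fg(2)] by blast
      obtain m' where m': "snd ` set m' \<subseteq> carrier D" "\<forall>h\<in>alg_characters D. trig_eval m' h = cnj (trig_eval m h)"
        using trig_eval_cnj[OF m(1) D] by blast
      obtain p where p: "snd ` set p \<subseteq> carrier D" 
        "\<forall>h\<in>alg_characters D. trig_eval p h = trig_eval l h * trig_eval (m @ m') h"
        using trig_eval_times[OF l(1) _ D, of "m @ m'"] m(1) m'(1)
        by (metis image_Un set_append sup.bounded_iff)
      \<comment> \<open>The factor 1/2 of the real-part identity enters as a monomial at the trivial
        frequency, where every homomorphism takes the value 1.\<close>
      obtain q where q: "snd ` set q \<subseteq> carrier D" 
        "\<forall>h\<in>alg_characters D. trig_eval q h = (1/2) * h \<one>\<^bsub>D\<^esub> * trig_eval p h"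
        using trig_eval_scale[OF p(1) one_closed D] by blast
      show ?thesis
      proof (rule RI[OF q(1)])
        fix h assume h: "h \<in> alg_characters D"
        then have "trig_eval q h = (trig_eval l h * (trig_eval m h + cnj (trig_eval m h))) / 2"
          using q p m' by (simp add: alg_characters_one[OF D])
        then show "f h * g h = Re (trig_eval q h)"
          using l m h by (simp add: complex_add_cnj)
      qed
    qed
    show "(\<lambda>_. c) \<in> R" for c
      by (rule RI[of "[(of_real c, \<one>\<^bsub>D\<^esub>)]"]) (auto simp: alg_characters_one[OF D])
    show "\<exists>f\<in>R. f h \<noteq> f k" if "h \<in> A \<union> B" "k \<in> A \<union> B" "h \<noteq> k" for h k
    proof -
      have "h \<in> alg_characters D" "k \<in> alg_characters D" using that sub by auto
      then have "h \<in> extensional (carrier D)" "k \<in> extensional (carrier D)"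
        by (auto simp: alg_characters_iff)
      then obtain x where x: "x \<in> carrier D" "h x \<noteq> k x"
        using \<open>h \<noteq> k\<close> extensionalityI by blast
      consider "Re (h x) \<noteq> Re (k x)" | "Im (h x) \<noteq> Im (k x)"
        using x complex_eq_iff by blast
      then show ?thesis
      proof cases
        case 1
        then show ?thesis
          using x by (intro bexI[of _ "\<lambda>h. Re (h x)"] RI[of "[(1, x)]"]) auto
      next
        case 2
        then show ?thesis
          \<comment> \<open>The coefficient -i turns imaginary parts into real ones.\<close>
          using x by (intro bexI[of _ "\<lambda>h. Im (h x)"] RI[of "[(-\<i>, x)]"]) auto
      qed
    qed
  qed
  obtain f where f: "f \<in> R" "\<forall>x\<in>A. f x < 1/3" "\<forall>x\<in>B. f x > 1 - 1/3"
    using two[of A B "1/3"] compact_imp_closed[OF A(1)] compact_imp_closed[OF B(1)] \<open>A \<inter> B = {}\<close> by auto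
  obtain l where l: "snd ` set l \<subseteq> carrier D" "\<forall>h\<in>alg_characters D. f h = Re (trig_eval l h)"
    using RE[OF f(1)] by blast
  have "Re (trig_eval l h) \<le> 1/3" if "h \<in> A" for h
    using f(2) l(2) A(2) that by (metis less_imp_le subsetD)
  moreover have "Re (trig_eval l h) \<ge> 2/3" if "h \<in> B" for h
  proof -
    have "f h = Re (trig_eval l h)" using l(2) B(2) that by blast
    then show ?thesis using f(3) that by fastforce
  qed
  ultimately show ?thesis using l(1) by blast
qed

section \<open>Averaging and the double annihilator theorem\<close>

text \<open>For z different from 1 the geometric sum stays below 2 / norm (z - 1), so dividing by N
  sends it to 0. This orthogonality relation stands in for integration over a compact group.\<close>

lemma cesaro_mean_powers:
  fixes z :: complex
  assumes "norm z = 1"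
  shows "(\<lambda>N. (\<Sum>j<N. z ^ j) / of_nat N) \<longlonglongrightarrow> (if z = 1 then 1 else 0)"
proof (cases "z = 1")
  case True
  have "eventually (\<lambda>N. (1::complex) = (\<Sum>j<N. z ^ j) / of_nat N) sequentially"
    using eventually_gt_at_top[of 0] by eventually_elim (simp add: True)
  then show ?thesis
    unfolding if_P[OF True] by (rule Lim_transform_eventually[OF tendsto_const])
next
  case False
  have "(\<lambda>N. (2 / norm (z - 1)) * inverse (real N)) \<longlonglongrightarrow> (2 / norm (z - 1)) * 0"
    by (intro tendsto_intros lim_inverse_n)
  then have lim: "(\<lambda>N. (2 / norm (z - 1)) * inverse (real N)) \<longlonglongrightarrow> 0" by simp
  have "norm ((\<Sum>j<N. z ^ j) / of_nat N) \<le> (2 / norm (z - 1)) * inverse (real N)" for N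
  proof -
    have "norm (z ^ N - 1) \<le> norm (z ^ N) + norm (1 :: complex)"
      by (rule norm_triangle_ineq4)
    also have "\<dots> = 2" using assms by (simp add: norm_power)
    finally have "norm (z ^ N - 1) \<le> 2" .
    then show ?thesis
      by (simp add: geometric_sum False norm_divide norm_mult divide_right_mono flip: divide_inverse)
  qed
  then show ?thesis
    unfolding if_not_P[OF False] by (intro Lim_null_comparison[OF _ lim] always_eventually allI)
qed

text \<open>On the frequency x, translation by \<open>t\<close> acts as multiplication by t x.
  Averaging over the powers of \<open>t\<close> is therefore the projection onto the frequencies
  that \<open>t\<close> annihilates.\<close>

lemma trig_eval_mean:
  assumes "\<forall>x\<in>snd ` set l. norm (t x) = 1"
  shows "(\<lambda>N. (\<Sum>j<N. trig_eval l (\<lambda>x. t x ^ j * h x)) / of_nat N)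
    \<longlonglongrightarrow> trig_eval (filter (\<lambda>p. t (snd p) = 1) l) h"
  using assms
proof (induction l)
  case (Cons p l)
  have "(\<Sum>j<N. trig_eval (p # l) (\<lambda>x. t x ^ j * h x)) / of_nat N =
     fst p * h (snd p) * ((\<Sum>j<N. t (snd p) ^ j) / of_nat N) +
     (\<Sum>j<N. trig_eval l (\<lambda>x. t x ^ j * h x)) / of_nat N" for N
    by (simp add: sum.distrib add_divide_distrib sum_distrib_left mult_ac)
  moreover have "(\<lambda>N. fst p * h (snd p) * ((\<Sum>j<N. t (snd p) ^ j) / of_nat N) +
     (\<Sum>j<N. trig_eval l (\<lambda>x. t x ^ j * h x)) / of_nat N) \<longlonglongrightarrow>
     fst p * h (snd p) * (if t (snd p) = 1 then 1 else 0) + trig_eval (filter (\<lambda>p. t (snd p) = 1) l) h"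
    using Cons by (intro tendsto_intros cesaro_mean_powers) auto
  ultimately show ?case by (auto simp del: trig_eval_simps(2) simp: trig_eval_simps(2)[of p "filter _ l"])
qed simp

text \<open>Averaging over the powers of an element t of H keeps both bounds and deletes the terms on
  which t is nontrivial; once only terms annihilated by H (hence by b) are left, the two bounds
  contradict each other at 1 and b.\<close>

lemma trig_no_separation:
  assumes H: "H \<subseteq> alg_characters D" "(\<lambda>x\<in>carrier D. 1) \<in> H"
    "\<And>g h. g \<in> H \<Longrightarrow> h \<in> H \<Longrightarrow> (\<lambda>x\<in>carrier D. g x * h x) \<in> H"
    and ann: "\<And>x. x \<in> carrier D \<Longrightarrow> (\<forall>h\<in>H. h x = 1) \<Longrightarrow> b x = 1"
    and l: "snd ` set l \<subseteq> carrier D" "\<And>h. h \<in> H \<Longrightarrow> Re (trig_eval l h) \<le> 1/3"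
      "\<And>h. h \<in> H \<Longrightarrow> Re (trig_eval l (\<lambda>x\<in>carrier D. b x * h x)) \<ge> 2/3"
  shows False
  using l
proof (induction l rule: length_induct)
  case (1 l)
  note l = "1.prems"
  have restr: "trig_eval l' (\<lambda>x\<in>carrier D. f x) = trig_eval l' f" if "set l' \<subseteq> set l" for f l'
    using l(1) that by (intro trig_eval_cong) auto
  show False
  proof (cases "\<exists>t\<in>H. \<exists>x\<in>snd ` set l. t x \<noteq> 1")
    case True
    then obtain t x where t: "t \<in> H" "x \<in> snd ` set l" "t x \<noteq> 1" by blast
    define l' where "l' = filter (\<lambda>p. t (snd p) = 1) l"
    have l'l: "set l' \<subseteq> set l" by (auto simp: l'_def)
    have pow: "(\<lambda>x\<in>carrier D. t x ^ j * h x) \<in> H" if "h \<in> H" for h j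
    proof (induction j)
      case 0
      have "(\<lambda>x\<in>carrier D. (\<lambda>x\<in>carrier D. 1) x * h x) \<in> H" using H that by blast
      moreover have "(\<lambda>x\<in>carrier D. (\<lambda>x\<in>carrier D. 1) x * h x) = (\<lambda>x\<in>carrier D. t x ^ 0 * h x)"
        by (rule restrict_ext) simp
      ultimately show ?case by metis
    next
      case (Suc j)
      have "(\<lambda>x\<in>carrier D. t x * (\<lambda>x\<in>carrier D. t x ^ j * h x) x) \<in> H" using H Suc t by blast
      moreover have "(\<lambda>x\<in>carrier D. t x * (\<lambda>x\<in>carrier D. t x ^ j * h x) x)
          = (\<lambda>x\<in>carrier D. t x ^ Suc j * h x)"
        by (rule restrict_ext) simp
      ultimately show ?case by metis
    qed
    have norm: "\<forall>x\<in>snd ` set l. norm (t x) = 1"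
      using alg_characters_norm[OF subsetD[OF H(1) t(1)]] l(1) by (simp add: subset_iff)
    have lim: "(\<lambda>N. Re ((\<Sum>j<N. trig_eval l (\<lambda>x. t x ^ j * f x)) / of_nat N)) \<longlonglongrightarrow> Re (trig_eval l' f)" for f
      unfolding l'_def by (intro tendsto_intros trig_eval_mean norm)
    have "Re (trig_eval l' h) \<le> 1/3" if h: "h \<in> H" for h
    proof (rule LIMSEQ_le_const2[OF lim])
      have "Re ((\<Sum>j<N. trig_eval l (\<lambda>x. t x ^ j * h x)) / of_nat N) \<le> 1/3" if "N \<ge> 1" for N
      proof -
        have "(\<Sum>j<N. Re (trig_eval l (\<lambda>x. t x ^ j * h x))) \<le> (\<Sum>j<N. 1/3)"
          using l(2)[OF pow[OF h], unfolded restr[OF subset_refl]] by (intro sum_mono)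
        then show ?thesis using that by (simp add: field_simps)
      qed
      then show "\<exists>N. \<forall>n\<ge>N. Re ((\<Sum>j<n. trig_eval l (\<lambda>x. t x ^ j * h x)) / of_nat n) \<le> 1/3"
        by blast
    qed
    moreover have "Re (trig_eval l' (\<lambda>x\<in>carrier D. b x * h x)) \<ge> 2/3" if h: "h \<in> H" for h
    proof -
      have "Re ((\<Sum>j<N. trig_eval l (\<lambda>x. t x ^ j * (b x * h x))) / of_nat N) \<ge> 2/3" if "N \<ge> 1" for N
      proof -
        \<comment> \<open>The j-th power of \<open>t\<close> times \<open>h\<close> is again in
          \<open>H\<close>, so the lower bound on the translate of \<open>H\<close> by
          \<open>b\<close> applies to every summand.\<close>
        have "2/3 \<le> Re (trig_eval l (\<lambda>x. t x ^ j * (b x * h x)))" for j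
        proof -
          have "trig_eval l (\<lambda>x\<in>carrier D. b x * (\<lambda>x\<in>carrier D. t x ^ j * h x) x)
            = trig_eval l (\<lambda>x. t x ^ j * (b x * h x))"
            using l(1) by (intro trig_eval_cong) (auto simp: subset_iff mult_ac)
          then show ?thesis using l(3)[OF pow[OF h], of j] by metis
        qed
        then have "(\<Sum>j<N. 2/3) \<le> (\<Sum>j<N. Re (trig_eval l (\<lambda>x. t x ^ j * (b x * h x))))"
          by (intro sum_mono)
        then show ?thesis using that by (simp add: field_simps)
      qed
      then have "2/3 \<le> Re (trig_eval l' (\<lambda>x. b x * h x))"
        by (intro LIMSEQ_le_const[OF lim]) blast
      then show ?thesis unfolding restr[OF l'l] .
    qed
    moreover have "length l' < length l"
      using t unfolding l'_def by (auto intro: length_filter_less)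
    moreover have "snd ` set l' \<subseteq> carrier D" using l'l l(1) by blast
    ultimately show False using "1.IH" by blast
  next
    case False
    have "trig_eval l (\<lambda>x\<in>carrier D. b x * (\<lambda>x\<in>carrier D. 1) x) = trig_eval l (\<lambda>x\<in>carrier D. 1)"
    proof (rule trig_eval_cong)
      fix x assume x: "x \<in> snd ` set l"
      then have "x \<in> carrier D" "b x = 1" using l(1) False ann[of x] by blast+
      then show "(\<lambda>x\<in>carrier D. b x * (\<lambda>x\<in>carrier D. 1) x) x = (\<lambda>x\<in>carrier D. 1) x" by simp
    qed
    then have "2/3 \<le> Re (trig_eval l (\<lambda>x\<in>carrier D. 1))" using l(3)[OF H(2)] by metis
    then show False using l(2)[OF H(2)] by linarith
  qed
qed

text \<open>Closure under products and conjugates makes \<open>H\<close> a group, conjugation being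
  inversion on the circle. \<open>D\<close> carries no topology: it will be the dual of the group
  and the dual of the quotient, and \<open>b\<close> any homomorphism on them.\<close>

theorem compact_subgroup_double_annihilator:
  assumes D: "group D" and H: "compact H" "H \<subseteq> alg_characters D" "(\<lambda>x\<in>carrier D. 1) \<in> H"
    "\<And>g h. g \<in> H \<Longrightarrow> h \<in> H \<Longrightarrow> (\<lambda>x\<in>carrier D. g x * h x) \<in> H"
    "\<And>h. h \<in> H \<Longrightarrow> (\<lambda>x\<in>carrier D. cnj (h x)) \<in> H"
    and b: "b \<in> alg_characters D"
    and ann: "\<And>x. x \<in> carrier D \<Longrightarrow> (\<forall>h\<in>H. h x = 1) \<Longrightarrow> b x = 1"
  shows "b \<in> H"
proof (rule ccontr)
  assume "b \<notin> H"
  define m where "m h = (\<lambda>x\<in>carrier D. b x * h x)" for h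
  have "continuous_on H (\<lambda>h. m h x)" for x
    unfolding m_def restrict_def
    by (cases "x \<in> carrier D") (auto intro!: continuous_intros continuous_on_coordinate)
  then have "continuous_on H m"
    by (rule continuous_on_coordinatewise_then_product)
  then have "compact (m ` H)" using H(1) compact_continuous_image by blast
  moreover have "m ` H \<subseteq> alg_characters D"
    using H(2) b D by (auto simp: m_def alg_characters_iff norm_mult group.is_monoid monoid.m_closed)
  moreover have "H \<inter> m ` H = {}"
  proof -
    have False if "h \<in> H" "m h \<in> H" for h
    proof -
      \<comment> \<open>If b * h were in \<open>H\<close>, multiplying by the inverse of h would put
        \<open>b\<close> in \<open>H\<close>. Hence \<open>H\<close> and its translate are
        disjoint.\<close>
      have "(\<lambda>x\<in>carrier D. m h x * (\<lambda>x\<in>carrier D. cnj (h x)) x) \<in> H" using H that by blast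
      moreover have "(\<lambda>x\<in>carrier D. m h x * (\<lambda>x\<in>carrier D. cnj (h x)) x) = b"
      proof (rule extensionalityI[of _ "carrier D"])
        fix x assume x: "x \<in> carrier D"
        then have "h x * cnj (h x) = 1"
          using H(2) \<open>h \<in> H\<close> alg_characters_norm[of h D x] by (auto simp flip: complex_norm_square)
        then show "(\<lambda>x\<in>carrier D. m h x * (\<lambda>x\<in>carrier D. cnj (h x)) x) x = b x"
          using x by (simp add: m_def mult.assoc)
      qed (use b in \<open>auto simp: alg_characters_iff\<close>)
      ultimately show False using \<open>b \<notin> H\<close> by simp
    qed
    then show ?thesis by blast
  qed
  ultimately have "\<exists>l. snd ` set l \<subseteq> carrier D \<and> (\<forall>h\<in>H. Re (trig_eval l h) \<le> 1/3) \<and>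
    (\<forall>h\<in>m ` H. Re (trig_eval l h) \<ge> 2/3)"
    by (rule trig_separation[OF D H(1,2)])
  then obtain l where l: "snd ` set l \<subseteq> carrier D" "\<forall>h\<in>H. Re (trig_eval l h) \<le> 1/3"
    "\<forall>h\<in>m ` H. Re (trig_eval l h) \<ge> 2/3"
    by blast
  show False
    using l(2,3) by (intro trig_no_separation[OF H(2,3,4) ann l(1)]) (auto simp: m_def)
qed

section \<open>The dual group and the evaluation map\<close>

lemma continuous_map_euclidean_dist:
  fixes f :: "'a \<Rightarrow> 'b::metric_space"
  shows "continuous_map T euclidean f \<longleftrightarrow>
    (\<forall>x\<in>topspace T. \<forall>e>0. \<exists>U. openin T U \<and> x \<in> U \<and> (\<forall>y\<in>U. dist (f y) (f x) < e))"
    (is "?L \<longleftrightarrow> ?R")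
proof
  assume L: ?L
  show ?R
  proof (intro ballI allI impI)
    fix x and e :: real assume x: "x \<in> topspace T" and e: "e > 0"
    have "openin T {y \<in> topspace T. f y \<in> ball (f x) e}"
      using L by (rule openin_continuous_map_preimage) simp
    then show "\<exists>U. openin T U \<and> x \<in> U \<and> (\<forall>y\<in>U. dist (f y) (f x) < e)"
      using x e by (intro exI[of _ "{y \<in> topspace T. f y \<in> ball (f x) e}"]) (auto simp: dist_commute)
  qed
next
  assume R: ?R
  show ?L
    unfolding continuous_map
  proof (intro conjI allI impI)
    fix V :: "'b set" assume "openin euclidean V"
    then have V: "open V" by simp
    show "openin T {x \<in> topspace T. f x \<in> V}"
    proof (subst openin_subopen, safe)
      fix x assume x: "x \<in> topspace T" "f x \<in> V"
      then obtain e where e: "e > 0" "\<forall>y. dist y (f x) < e \<longrightarrow> y \<in> V"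
        using V open_dist by blast
      then obtain U where "openin T U" "x \<in> U" "\<forall>y\<in>U. dist (f y) (f x) < e"
        using R[rule_format, OF x(1) e(1)] by blast
      then show "\<exists>S. openin T S \<and> x \<in> S \<and> S \<subseteq> {x \<in> topspace T. f x \<in> V}"
        using e openin_subset[of T U] by (intro exI[of _ U]) auto
    qed
  qed simp
qed

lemma characters_eq:
  assumes "topspace T = carrier G"
  shows "ch \<in> characters G T \<longleftrightarrow> ch \<in> alg_characters G \<and> continuous_map T euclidean ch"
  using assms unfolding characters_def alg_characters_def circle_top_def continuous_map_in_subtopology
  by (auto simp: hom_def circle_group_def)

lemma characters_alg: "ch \<in> characters G T \<Longrightarrow> ch \<in> alg_characters G"
  by (auto simp: characters_def alg_characters_def)

lemma characters_continuous: "ch \<in> characters G T \<Longrightarrow> continuous_map T euclidean ch"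
  by (auto simp: characters_def circle_top_def continuous_map_in_subtopology)

lemma characters_extensionalityI:
  assumes "f \<in> characters G T" "g \<in> characters G T" "\<And>x. x \<in> carrier G \<Longrightarrow> f x = g x"
  shows "f = g"
  using assms by (intro extensionalityI[of _ "carrier G"]) (auto simp: characters_def)

section \<open>The compact-open topology as uniform convergence on compact sets\<close>

lemma topspace_dual_top [simp]: "topspace (dual_top G T) = characters G T"
proof -
  \<comment> \<open>With an empty compact set the subbasic condition is void, so the set of all
    characters is itself subbasic.\<close>
  have "{ch \<in> characters G T. ch ` {} \<subseteq> {}} \<in> {{ch \<in> characters G T. ch ` C \<subseteq> U} | C U. compactin T C \<and> openin circle_top U}"
    by (intro CollectI exI[of _ "{}"]) auto
  then show ?thesis
    unfolding dual_top_def topology_generated_by_topspace by auto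
qed

text \<open>Uniform closeness on \<open>C\<close> follows from finitely many subbasic conditions.
  Cover the circle by balls of radius e/3, cut \<open>C\<close> into the pieces where
  \<open>ch\<close> is within e/3 of a centre z, and ask \<open>ps\<close> to send each piece into
  the ball of radius e/2 around its z; then e/2 + e/3 < e.\<close>

lemma dual_top_uniform_nbhd:
  assumes ch: "ch \<in> characters G T" and C: "compactin T C" and e: "e > 0"
  shows "\<exists>W. openin (dual_top G T) W \<and> ch \<in> W \<and> (\<forall>ps\<in>W. \<forall>x\<in>C. dist (ps x) (ch x) < e)"
proof -
  have "compact (sphere (0::complex) 1)" by simp
  then obtain Z where Z: "finite Z" "sphere (0::complex) 1 \<subseteq> (\<Union>z\<in>Z. ball z (e/3))"
    using compact_imp_seq_compact seq_compact_imp_totally_bounded e by (metis zero_less_divide_iff zero_less_numeral)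
  \<comment> \<open>Closed balls make the pieces compact; the open balls of larger radius e/2 then
    give open conditions that \<open>ch\<close> satisfies.\<close>
  define C' where "C' z = {x \<in> topspace T. ch x \<in> cball z (e/3)} \<inter> C" for z
  define W' where "W' z = {ps \<in> characters G T. ps ` C' z \<subseteq> sphere 0 1 \<inter> ball z (e/2)}" for z
  have "closedin T {x \<in> topspace T. ch x \<in> cball z (e/3)}" for z
    by (rule closedin_continuous_map_preimage[OF characters_continuous[OF ch]]) simp
  then have "compactin T (C' z)" for z
    unfolding C'_def using C by (rule closed_Int_compactin)
  then have "openin (dual_top G T) (W' z)" for z
    unfolding dual_top_def W'_def
    by (intro topology_generated_by_Basis CollectI exI[of _ "C' z"] exI[of _ "sphere 0 1 \<inter> ball z (e/2)"])
      (auto simp: circle_top_def openin_open)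
  then have "openin (dual_top G T) (topspace (dual_top G T) \<inter> (\<Inter>z\<in>Z. W' z))"
    by (cases "Z = {}") (auto intro!: openin_Int openin_Inter Z openin_topspace simp del: topspace_dual_top)
  moreover have img: "ps x \<in> sphere 0 1" if "ps \<in> characters G T" "x \<in> topspace T" for ps x
    using that by (auto simp: characters_def circle_top_def continuous_map_in_subtopology)
  have Ct: "C \<subseteq> topspace T" using C compactin_subset_topspace by blast
  have "ch \<in> topspace (dual_top G T) \<inter> (\<Inter>z\<in>Z. W' z)"
    using ch img[OF ch] e unfolding W'_def C'_def by (fastforce simp: dist_commute)
  moreover have "dist (ps x) (ch x) < e" if ps: "ps \<in> topspace (dual_top G T) \<inter> (\<Inter>z\<in>Z. W' z)" and x: "x \<in> C" for ps x
  proof -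
    obtain z where z: "z \<in> Z" "ch x \<in> ball z (e/3)" using Z img[OF ch, of x] Ct x by blast
    then have "x \<in> C' z" using x Ct unfolding C'_def by auto
    then have "ps x \<in> ball z (e/2)" using ps z unfolding W'_def by blast
    then have "dist (ps x) (ch x) < e/2 + e/3"
      using z dist_triangle3[of "ps x" "ch x" z] by simp
    then show ?thesis using e by simp
  qed
  ultimately show ?thesis by blast
qed

text \<open>A compact image inside an open set has a whole e-neighbourhood inside it, so subbasic
  sets are open for uniform convergence on compact sets; the converse is
  \<open>dual_top_uniform_nbhd\<close>. Later openness proofs in the dual use this
  description.\<close>

lemma openin_dual_top:
  "openin (dual_top G T) W \<longleftrightarrow> W \<subseteq> characters G T \<and>
    (\<forall>ch\<in>W. \<exists>C e. compactin T C \<and> e > 0 \<and>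
       (\<forall>ps\<in>characters G T. (\<forall>x\<in>C. dist (ps x) (ch x) < e) \<longrightarrow> ps \<in> W))" (is "_ \<longleftrightarrow> ?P W")
proof
  assume "openin (dual_top G T) W"
  then have "generate_topology_on {{ch \<in> characters G T. ch ` C \<subseteq> U} | C U. compactin T C \<and> openin circle_top U} W"
    by (simp add: dual_top_def openin_topology_generated_by_iff)
  then show "?P W"
  proof induction
    case (Int a b)
    show ?case
    proof (intro conjI ballI)
      show "a \<inter> b \<subseteq> characters G T" using Int.IH by blast
      fix ch assume "ch \<in> a \<inter> b"
      then obtain C e C' e' where "compactin T C" "e > 0" "compactin T C'" "e' > 0"
        "\<forall>ps\<in>characters G T. (\<forall>x\<in>C. dist (ps x) (ch x) < e) \<longrightarrow> ps \<in> a"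
        "\<forall>ps\<in>characters G T. (\<forall>x\<in>C'. dist (ps x) (ch x) < e') \<longrightarrow> ps \<in> b"
        using Int.IH by blast
      then show "\<exists>C e. compactin T C \<and> e > 0 \<and>
         (\<forall>ps\<in>characters G T. (\<forall>x\<in>C. dist (ps x) (ch x) < e) \<longrightarrow> ps \<in> a \<inter> b)"
        by (intro exI[of _ "C \<union> C'"] exI[of _ "min e e'"]) (auto intro: compactin_Un)
    qed
  next
    case (UN K)
    show ?case
    proof (intro conjI ballI)
      show "\<Union> K \<subseteq> characters G T" using UN by blast
      fix ch assume "ch \<in> \<Union> K"
      then obtain k where k: "k \<in> K" "ch \<in> k" by blast
      then obtain C e where "compactin T C" "e > 0"
        "\<forall>ps\<in>characters G T. (\<forall>x\<in>C. dist (ps x) (ch x) < e) \<longrightarrow> ps \<in> k"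
        using UN.IH[OF k(1)] by blast
      then show "\<exists>C e. compactin T C \<and> e > 0 \<and>
         (\<forall>ps\<in>characters G T. (\<forall>x\<in>C. dist (ps x) (ch x) < e) \<longrightarrow> ps \<in> \<Union> K)"
        using k by blast
    qed
  next
    case (Basis s)
    then obtain C U where s: "s = {ch \<in> characters G T. ch ` C \<subseteq> U}" "compactin T C" "openin circle_top U"
      by blast
    obtain V where V: "open V" "U = sphere 0 1 \<inter> V"
      using s(3) unfolding circle_top_def openin_open by blast
    show ?case
    proof (intro conjI ballI)
      show "s \<subseteq> characters G T" using s by blast
      fix ch assume "ch \<in> s"
      then have ch: "ch \<in> characters G T" "ch ` C \<subseteq> V" using s V by auto
      have "compact (ch ` C)"
        using image_compactin[OF s(2) characters_continuous[OF ch(1)]] by simp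
      then obtain e where e: "e > 0" "(\<Union>z\<in>ch ` C. ball z e) \<subseteq> V"
        using compact_subset_open_imp_ball_epsilon_subset V(1) ch(2) by metis
      have "ps \<in> s" if ps: "ps \<in> characters G T" "\<forall>x\<in>C. dist (ps x) (ch x) < e" for ps
      proof -
        have "ps x \<in> V" if "x \<in> C" for x
        proof -
          have "ps x \<in> ball (ch x) e" using ps(2) that by (simp add: dist_commute)
          then show ?thesis using e(2) that by blast
        qed
        moreover have "ps x \<in> sphere 0 1" if "x \<in> C" for x
          using ps(1) that compactin_subset_topspace[OF s(2)]
          by (auto simp: characters_def circle_top_def continuous_map_in_subtopology)
        ultimately show ?thesis using ps(1) s(1) V(2) by auto
      qed
      then show "\<exists>C e. compactin T C \<and> e > 0 \<and>
         (\<forall>ps\<in>characters G T. (\<forall>x\<in>C. dist (ps x) (ch x) < e) \<longrightarrow> ps \<in> s)"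
        using s(2) e(1) by blast
    qed
  qed simp
next
  assume P: "?P W"
  show "openin (dual_top G T) W"
  proof (subst openin_subopen, intro ballI)
    fix ch assume ch: "ch \<in> W"
    then obtain C e where C: "compactin T C" "e > 0"
       "\<forall>ps\<in>characters G T. (\<forall>x\<in>C. dist (ps x) (ch x) < e) \<longrightarrow> ps \<in> W" using P by blast
    obtain V where V: "openin (dual_top G T) V" "ch \<in> V" "\<forall>ps\<in>V. \<forall>x\<in>C. dist (ps x) (ch x) < e"
      using dual_top_uniform_nbhd[OF subsetD[OF conjunct1[OF P] ch] C(1,2)] by blast
    have "V \<subseteq> characters G T" using openin_subset[OF V(1)] by simp
    then show "\<exists>V. openin (dual_top G T) V \<and> ch \<in> V \<and> V \<subseteq> W"
      using V C(3) by (intro exI[of _ V] conjI subsetI) auto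
  qed
qed

section \<open>Groups with continuous translations\<close>

text \<open>One framework for the group, its dual and its quotient. Continuity of translations is
  quickly checked for all three and suffices to move questions of continuity and openness to the
  identity.\<close>

locale semitopological_comm_group = comm_group G for G :: "'a monoid" (structure) +
  fixes T :: "'a topology"
  assumes topspace_eq: "topspace T = carrier G"
    and translation: "a \<in> carrier G \<Longrightarrow> continuous_map T T (\<lambda>x. a \<otimes> x)"
begin

lemma openin_translate:
  assumes "openin T U" "a \<in> carrier G"
  shows "openin T {x \<in> carrier G. a \<otimes> x \<in> U}"
  using openin_continuous_map_preimage[OF translation[OF assms(2)] assms(1)] by (simp add: topspace_eq)

lemma one_in_characters: "(\<lambda>x\<in>carrier G. 1) \<in> characters G T"
proof -
  have "continuous_map T euclidean (\<lambda>x\<in>carrier G. 1 :: complex)"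
    by (rule continuous_map_eq[of _ _ "\<lambda>_. 1"]) (auto simp: topspace_eq)
  then show ?thesis by (auto simp: characters_eq[OF topspace_eq] alg_characters_iff)
qed

lemma mult_in_characters:
  assumes "f \<in> characters G T" "g \<in> characters G T"
  shows "(\<lambda>x\<in>carrier G. f x * g x) \<in> characters G T"
proof -
  have "continuous_map T euclidean (\<lambda>x. f x * g x)"
  proof -
    have "continuous_map T (prod_topology euclidean euclidean) (\<lambda>x. (f x, g x))"
      using assms by (intro continuous_map_pairedI characters_continuous)
    moreover have "continuous_on UNIV (\<lambda>p :: complex \<times> complex. fst p * snd p)"
      by (intro continuous_intros)
    ultimately show ?thesis
      using continuous_map_compose[of T euclidean "\<lambda>x. (f x, g x)" euclidean "\<lambda>p. fst p * snd p"]
      by (simp add: o_def)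
  qed
  then have "continuous_map T euclidean (\<lambda>x\<in>carrier G. f x * g x)"
    by (rule continuous_map_eq) (auto simp: topspace_eq)
  then show ?thesis
    using assms by (auto simp: characters_eq[OF topspace_eq] alg_characters_iff norm_mult)
qed

lemma cnj_in_characters:
  assumes "f \<in> characters G T"
  shows "(\<lambda>x\<in>carrier G. cnj (f x)) \<in> characters G T"
proof -
  have "continuous_map T euclidean (cnj \<circ> f)"
    using assms by (intro continuous_map_compose[OF characters_continuous])
      (auto intro: continuous_intros)
  then have "continuous_map T euclidean (\<lambda>x\<in>carrier G. cnj (f x))"
    by (rule continuous_map_eq) (auto simp: topspace_eq)
  then show ?thesis
    using assms by (auto simp: characters_eq[OF topspace_eq] alg_characters_iff)
qed

lemma cnj_mult_character:
  assumes "f \<in> characters G T" "x \<in> carrier G"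
  shows "cnj (f x) * f x = 1"
  using alg_characters_norm[OF characters_alg[OF assms(1)] assms(2)]
  by (metis complex_norm_square mult.commute of_real_1 power_one)

lemma dual_comm_group: "comm_group (dual_group G T)"
proof (rule comm_groupI)
  show "\<exists>y\<in>carrier (dual_group G T). y \<otimes>\<^bsub>dual_group G T\<^esub> x = \<one>\<^bsub>dual_group G T\<^esub>"
    if "x \<in> carrier (dual_group G T)" for x
  proof
    have x: "x \<in> characters G T" using that by (simp add: dual_group_def)
    show "(\<lambda>a\<in>carrier G. cnj (x a)) \<in> carrier (dual_group G T)"
      using cnj_in_characters[OF x] by (simp add: dual_group_def)
    show "(\<lambda>a\<in>carrier G. cnj (x a)) \<otimes>\<^bsub>dual_group G T\<^esub> x = \<one>\<^bsub>dual_group G T\<^esub>"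
      using x by (auto simp: dual_group_def cnj_mult_character intro!: restrict_ext)
  qed
  show "\<one>\<^bsub>dual_group G T\<^esub> \<otimes>\<^bsub>dual_group G T\<^esub> x = x" if "x \<in> carrier (dual_group G T)" for x
    using that by (intro extensionalityI[of _ "carrier G"]) (auto simp: dual_group_def characters_def)
qed (auto simp: dual_group_def one_in_characters mult_in_characters mult_ac intro!: restrict_ext)

text \<open>Multiplication by a fixed character preserves uniform distances on every compact set,
  because its values have norm 1.\<close>

lemma dual_semitopological: "semitopological_comm_group (dual_group G T) (dual_top G T)"
proof (intro semitopological_comm_group.intro dual_comm_group semitopological_comm_group_axioms.intro)
  show "topspace (dual_top G T) = carrier (dual_group G T)" by (simp add: dual_group_def)
  fix a assume "a \<in> carrier (dual_group G T)"
  then have a: "a \<in> characters G T" by (simp add: dual_group_def)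
  show "continuous_map (dual_top G T) (dual_top G T) (\<lambda>x. a \<otimes>\<^bsub>dual_group G T\<^esub> x)"
    unfolding continuous_map
  proof (intro conjI allI impI)
    show "(\<lambda>x. a \<otimes>\<^bsub>dual_group G T\<^esub> x) ` topspace (dual_top G T) \<subseteq> topspace (dual_top G T)"
      using a by (auto simp: dual_group_def mult_in_characters)
    fix W assume W: "openin (dual_top G T) W"
    show "openin (dual_top G T) {x \<in> topspace (dual_top G T). a \<otimes>\<^bsub>dual_group G T\<^esub> x \<in> W}"
      unfolding openin_dual_top
    proof (intro conjI ballI)
      fix ch assume "ch \<in> {x \<in> topspace (dual_top G T). a \<otimes>\<^bsub>dual_group G T\<^esub> x \<in> W}"
      then have ch: "ch \<in> characters G T" "(\<lambda>x\<in>carrier G. a x * ch x) \<in> W" by (auto simp: dual_group_def)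
      then obtain C e where C: "compactin T C" "e > 0" "\<forall>ps\<in>characters G T.
          (\<forall>x\<in>C. dist (ps x) ((\<lambda>x\<in>carrier G. a x * ch x) x) < e) \<longrightarrow> ps \<in> W"
        using W unfolding openin_dual_top by blast
      have Cs: "C \<subseteq> carrier G" using compactin_subset_topspace[OF C(1)] by (simp add: topspace_eq)
      have "(\<lambda>x\<in>carrier G. a x * ps x) \<in> W" if ps: "ps \<in> characters G T" "\<forall>x\<in>C. dist (ps x) (ch x) < e" for ps
      proof -
        have "dist ((\<lambda>x\<in>carrier G. a x * ps x) x) ((\<lambda>x\<in>carrier G. a x * ch x) x) < e" if "x \<in> C" for x
        proof -
          have "x \<in> carrier G" using that Cs by blast
          then have "dist ((\<lambda>x\<in>carrier G. a x * ps x) x) ((\<lambda>x\<in>carrier G. a x * ch x) x) = dist (ps x) (ch x)"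
            using alg_characters_norm[OF characters_alg[OF a], of x]
            by (simp add: dist_norm norm_mult flip: right_diff_distrib)
          then show ?thesis using ps that by simp
        qed
        then show ?thesis using C(3) mult_in_characters[OF a ps(1)] by blast
      qed
      then show "\<exists>C e. compactin T C \<and> e > 0 \<and> (\<forall>ps\<in>characters G T. (\<forall>x\<in>C. dist (ps x) (ch x) < e) \<longrightarrow>
          ps \<in> {x \<in> topspace (dual_top G T). a \<otimes>\<^bsub>dual_group G T\<^esub> x \<in> W})"
        using C(1,2) by (intro exI[of _ C] exI[of _ e]) (auto simp: dual_group_def)
    qed auto
  qed
qed

text \<open>Dividing by h a, a number of norm 1, preserves distances. This is the device that
  carries estimates at \<open>a\<close> to the identity.\<close>

lemma dist_character_translate:
  assumes "h \<in> alg_characters G" "a \<in> carrier G" "x \<in> carrier G"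
  shows "dist (h (inv a \<otimes> x)) 1 = dist (h x) (h a)"
proof -
  have n: "norm (h a) = 1" using assms alg_characters_norm by metis
  then have "cnj (h a) * h a = 1"
    by (metis complex_norm_square mult.commute of_real_1 power_one)
  then have "h (inv a \<otimes> x) - 1 = cnj (h a) * (h x - h a)"
    using assms by (simp add: alg_characters_mult alg_characters_inv is_group algebra_simps)
  then show ?thesis using n by (simp add: dist_norm norm_mult)
qed

lemma character_if_continuous_at_one:
  assumes h: "h \<in> alg_characters G"
    and c: "\<And>e. e > 0 \<Longrightarrow> \<exists>U. openin T U \<and> \<one> \<in> U \<and> (\<forall>x\<in>U. dist (h x) 1 < e)"
  shows "h \<in> characters G T"
  unfolding characters_eq[OF topspace_eq] continuous_map_euclidean_dist
proof (intro conjI h ballI allI impI)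
  fix a and e :: real assume "a \<in> topspace T" "e > 0"
  then have a: "a \<in> carrier G" by (simp add: topspace_eq)
  obtain U where U: "openin T U" "\<one> \<in> U" "\<forall>x\<in>U. dist (h x) 1 < e"
    using c[OF \<open>e > 0\<close>] by blast
  have "openin T {x \<in> carrier G. inv a \<otimes> x \<in> U}"
    using U(1) a by (intro openin_translate) auto
  moreover have "a \<in> {x \<in> carrier G. inv a \<otimes> x \<in> U}" using a U(2) by simp
  moreover have "\<forall>x\<in>{x \<in> carrier G. inv a \<otimes> x \<in> U}. dist (h x) (h a) < e"
    using U(3) dist_character_translate[OF h a] by fastforce
  ultimately show "\<exists>U. openin T U \<and> a \<in> U \<and> (\<forall>y\<in>U. dist (h y) (h a) < e)" by blast
qed

section \<open>The evaluation homomorphism\<close>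

lemma eval_map_alg_character:
  assumes "a \<in> carrier G"
  shows "eval_map G T a \<in> alg_characters (dual_group G T)"
  using assms dual_comm_group
  by (auto simp: alg_characters_iff eval_map_def dual_group_def mult_in_characters
      intro: alg_characters_norm characters_alg)

lemma eval_map_character:
  assumes a: "a \<in> carrier G"
  shows "eval_map G T a \<in> characters (dual_group G T) (dual_top G T)"
proof -
  have "continuous_map (dual_top G T) euclidean (eval_map G T a)"
    unfolding continuous_map_euclidean_dist
  proof (intro ballI allI impI)
    fix ch and e :: real assume "ch \<in> topspace (dual_top G T)" "e > 0"
    then have ch: "ch \<in> characters G T" by simp
    have "compactin T {a}" using a by (simp add: topspace_eq)
    then obtain W where W: "openin (dual_top G T) W" "ch \<in> W" "\<forall>ps\<in>W. \<forall>x\<in>{a}. dist (ps x) (ch x) < e"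
      using dual_top_uniform_nbhd[OF ch _ \<open>e > 0\<close>] by blast
    have "W \<subseteq> characters G T" using openin_subset[OF W(1)] by simp
    then show "\<exists>U. openin (dual_top G T) U \<and> ch \<in> U \<and>
        (\<forall>y\<in>U. dist (eval_map G T a y) (eval_map G T a ch) < e)"
      using W ch by (intro exI[of _ W]) (auto simp: eval_map_def)
  qed
  then show ?thesis
    using eval_map_alg_character[OF a] characters_eq[of "dual_top G T" "dual_group G T"]
    by (simp add: dual_group_def)
qed

lemma eval_map_hom: "eval_map G T \<in> hom G (bidual_group G T)"
proof (rule homI)
  show "eval_map G T a \<in> carrier (bidual_group G T)" if "a \<in> carrier G" for a
    using eval_map_character[OF that] by (simp add: dual_group_def[of "dual_group G T"])
  show "eval_map G T (a \<otimes> b) = eval_map G T a \<otimes>\<^bsub>bidual_group G T\<^esub> eval_map G T b"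
    if "a \<in> carrier G" "b \<in> carrier G" for a b
    using that alg_characters_mult[OF characters_alg]
    by (auto simp: dual_group_def eval_map_def intro!: restrict_ext)
qed

text \<open>Compact sets of characters are equicontinuous at the identity. This is continuity of
  \<open>eval_map\<close> there with the bidual topology unfolded, so that only elements and
  characters are mentioned.\<close>

definition eval_continuous_at_one :: bool where
  "eval_continuous_at_one \<longleftrightarrow> (\<forall>C e. compactin (dual_top G T) C \<longrightarrow> e > 0 \<longrightarrow>
     (\<exists>U. openin T U \<and> \<one> \<in> U \<and> (\<forall>a\<in>U. \<forall>ch\<in>C. dist (ch a) 1 < e)))"

text \<open>At the identity the topology is no finer than the one pulled back from the bidual: every
  neighbourhood contains all points at which some compact set of characters is uniformly close to
  1.\<close>

definition eval_open_at_one :: bool where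
  "eval_open_at_one \<longleftrightarrow> (\<forall>U. openin T U \<longrightarrow> \<one> \<in> U \<longrightarrow>
     (\<exists>C e. compactin (dual_top G T) C \<and> e > 0 \<and>
        (\<forall>a\<in>carrier G. (\<forall>ch\<in>C. dist (ch a) 1 < e) \<longrightarrow> a \<in> U)))"

lemma eval_map_apply: "ch \<in> characters G T \<Longrightarrow> eval_map G T a ch = ch a"
  by (simp add: eval_map_def)

lemma compactin_dual_subset: "compactin (dual_top G T) C \<Longrightarrow> C \<subseteq> characters G T"
  using compactin_subset_topspace by fastforce

lemma character_at_one: "ch \<in> characters G T \<Longrightarrow> ch \<one> = 1"
  using alg_characters_one[OF is_group characters_alg] by blast

lemma continuous_eval_map_iff:
  "continuous_map T (bidual_top G T) (eval_map G T) \<longleftrightarrow> eval_continuous_at_one"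
proof
  assume cont: "continuous_map T (bidual_top G T) (eval_map G T)"
  show eval_continuous_at_one
    unfolding eval_continuous_at_one_def
  proof (intro allI impI)
    fix C and e :: real assume C: "compactin (dual_top G T) C" and e: "e > 0"
    obtain W where W: "openin (bidual_top G T) W" "eval_map G T \<one> \<in> W"
      "\<forall>P\<in>W. \<forall>ch\<in>C. dist (P ch) (eval_map G T \<one> ch) < e"
      using dual_top_uniform_nbhd[OF eval_map_character[OF one_closed] C e] by blast
    have "openin T {x \<in> topspace T. eval_map G T x \<in> W}"
      using openin_continuous_map_preimage[OF cont W(1)] .
    moreover have "dist (ch a) 1 < e" if "a \<in> {x \<in> topspace T. eval_map G T x \<in> W}" "ch \<in> C" for a ch
    proof -
      have "ch \<in> characters G T" using compactin_dual_subset[OF C] that by blast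
      moreover have "dist (eval_map G T a ch) (eval_map G T \<one> ch) < e" using W(3) that by blast
      ultimately show ?thesis by (simp add: eval_map_apply character_at_one)
    qed
    ultimately show "\<exists>U. openin T U \<and> \<one> \<in> U \<and> (\<forall>a\<in>U. \<forall>ch\<in>C. dist (ch a) 1 < e)"
      using W(2) by (intro exI[of _ "{x \<in> topspace T. eval_map G T x \<in> W}"]) (simp add: topspace_eq)
  qed
next
  assume c: eval_continuous_at_one
  show "continuous_map T (bidual_top G T) (eval_map G T)"
    unfolding continuous_map
  proof (intro conjI allI impI)
    show "eval_map G T ` topspace T \<subseteq> topspace (bidual_top G T)"
      using eval_map_character by (auto simp: topspace_eq)
    fix W assume W: "openin (bidual_top G T) W"
    show "openin T {x \<in> topspace T. eval_map G T x \<in> W}"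
    proof (subst openin_subopen, intro ballI)
      fix a assume "a \<in> {x \<in> topspace T. eval_map G T x \<in> W}"
      then have a: "a \<in> carrier G" "eval_map G T a \<in> W" by (auto simp: topspace_eq)
      then obtain C e where C: "compactin (dual_top G T) C" "e > 0"
        "\<forall>P\<in>characters (dual_group G T) (dual_top G T).
           (\<forall>ch\<in>C. dist (P ch) (eval_map G T a ch) < e) \<longrightarrow> P \<in> W"
        using W unfolding openin_dual_top[of "dual_group G T"] by blast
      obtain U where U: "openin T U" "\<one> \<in> U" "\<forall>x\<in>U. \<forall>ch\<in>C. dist (ch x) 1 < e"
        using c[unfolded eval_continuous_at_one_def] C(1,2) by blast
      have "eval_map G T x \<in> W" if x: "x \<in> carrier G" "inv a \<otimes> x \<in> U" for x
      proof -
        have "dist (eval_map G T x ch) (eval_map G T a ch) < e" if "ch \<in> C" for ch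
        proof -
          have "ch \<in> characters G T" using compactin_dual_subset[OF C(1)] that by blast
          moreover have "dist (ch (inv a \<otimes> x)) 1 < e" using U(3) x that by blast
          ultimately show ?thesis
            using dist_character_translate[OF characters_alg a(1) x(1)] by (simp add: eval_map_apply)
        qed
        then show ?thesis using C(3) eval_map_character[OF x(1)] by blast
      qed
      then show "\<exists>V. openin T V \<and> a \<in> V \<and> V \<subseteq> {x \<in> topspace T. eval_map G T x \<in> W}"
        using a U(2) openin_translate[OF U(1), of "inv a"]
        by (intro exI[of _ "{x \<in> carrier G. inv a \<otimes> x \<in> U}"]) (auto simp: topspace_eq)
    qed
  qed
qed

text \<open>Surjectivity turns each nearby element of the bidual into an evaluation, on which
  \<open>eval_open_at_one\<close> can act. Injectivity brings membership in the image of
  \<open>U\<close> back to membership in \<open>U\<close>.\<close>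

lemma open_eval_map_iff:
  assumes inj: "inj_on (eval_map G T) (carrier G)"
    and surj: "eval_map G T ` carrier G = carrier (bidual_group G T)"
  shows "open_map T (bidual_top G T) (eval_map G T) \<longleftrightarrow> eval_open_at_one"
proof
  assume op: "open_map T (bidual_top G T) (eval_map G T)"
  show eval_open_at_one
    unfolding eval_open_at_one_def
  proof (intro allI impI)
    fix U assume U: "openin T U" "\<one> \<in> U"
    have "openin (bidual_top G T) (eval_map G T ` U)"
      using op U(1) by (simp add: open_map_def)
    then obtain C e where C: "compactin (dual_top G T) C" "e > 0"
      "\<forall>P\<in>characters (dual_group G T) (dual_top G T).
         (\<forall>ch\<in>C. dist (P ch) (eval_map G T \<one> ch) < e) \<longrightarrow> P \<in> eval_map G T ` U"
      using U(2) unfolding openin_dual_top[of "dual_group G T"] by blast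
    have "a \<in> U" if a: "a \<in> carrier G" "\<forall>ch\<in>C. dist (ch a) 1 < e" for a
    proof -
      have "dist (eval_map G T a ch) (eval_map G T \<one> ch) < e" if "ch \<in> C" for ch
        using that a(2) compactin_dual_subset[OF C(1)] by (simp add: subset_iff eval_map_apply character_at_one)
      then have "eval_map G T a \<in> eval_map G T ` U"
        using C(3) eval_map_character[OF a(1)] by blast
      moreover have "U \<subseteq> carrier G" using openin_subset[OF U(1)] by (simp add: topspace_eq)
      ultimately show ?thesis using inj a(1) by (auto dest: inj_onD)
    qed
    then show "\<exists>C e. compactin (dual_top G T) C \<and> e > 0 \<and>
        (\<forall>a\<in>carrier G. (\<forall>ch\<in>C. dist (ch a) 1 < e) \<longrightarrow> a \<in> U)"
      using C(1,2) by blast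
  qed
next
  assume op: eval_open_at_one
  show "open_map T (bidual_top G T) (eval_map G T)"
    unfolding open_map_def
  proof (intro allI impI)
    fix U assume U: "openin T U"
    then have Us: "U \<subseteq> carrier G" using openin_subset topspace_eq by blast
    show "openin (bidual_top G T) (eval_map G T ` U)"
      unfolding openin_dual_top[of "dual_group G T"]
    proof (intro conjI ballI)
      show "eval_map G T ` U \<subseteq> characters (dual_group G T) (dual_top G T)"
        using eval_map_character Us by blast
      fix P assume "P \<in> eval_map G T ` U"
      then obtain a where a: "a \<in> U" "P = eval_map G T a" by blast
      have aG: "a \<in> carrier G" using a(1) Us by blast
      have "openin T {x \<in> carrier G. a \<otimes> x \<in> U}" "\<one> \<in> {x \<in> carrier G. a \<otimes> x \<in> U}"
        using openin_translate[OF U aG] a(1) aG by auto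
      then obtain C e where C: "compactin (dual_top G T) C" "e > 0"
        "\<forall>x\<in>carrier G. (\<forall>ch\<in>C. dist (ch x) 1 < e) \<longrightarrow> x \<in> {x \<in> carrier G. a \<otimes> x \<in> U}"
        using op[unfolded eval_open_at_one_def] by blast
      have "Q \<in> eval_map G T ` U"
        if Q: "Q \<in> characters (dual_group G T) (dual_top G T)" "\<forall>ch\<in>C. dist (Q ch) (P ch) < e" for Q
      proof -
        obtain x where x: "x \<in> carrier G" "Q = eval_map G T x"
          using Q(1) surj by (auto simp: dual_group_def[of "dual_group G T"])
        have "dist (ch (inv a \<otimes> x)) 1 < e" if "ch \<in> C" for ch
        proof -
          have ch: "ch \<in> characters G T" using compactin_dual_subset[OF C(1)] that by blast
          have "dist (Q ch) (P ch) < e" using Q(2) that by blast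
          then show ?thesis
            using ch unfolding dist_character_translate[OF characters_alg[OF ch] aG x(1)] x a
            by (simp add: eval_map_apply)
        qed
        then have "a \<otimes> (inv a \<otimes> x) \<in> U" using C(3) aG x(1) by blast
        then have "x \<in> U" using aG x(1) by (simp flip: m_assoc)
        then show ?thesis using x(2) by blast
      qed
      then show "\<exists>C e. compactin (dual_top G T) C \<and> e > 0 \<and>
        (\<forall>Q\<in>characters (dual_group G T) (dual_top G T).
          (\<forall>ch\<in>C. dist (Q ch) (P ch) < e) \<longrightarrow> Q \<in> eval_map G T ` U)"
        using C(1,2) by blast
    qed
  qed
qed

text \<open>Splits (c) into conditions that can be compared one at a time for the group and its
  quotient.\<close>

lemma top_group_iso_eval_map_iff:
  "top_group_iso G T (bidual_group G T) (bidual_top G T) (eval_map G T) \<longleftrightarrow>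
    inj_on (eval_map G T) (carrier G) \<and> eval_map G T ` carrier G = carrier (bidual_group G T) \<and>
    eval_continuous_at_one \<and> eval_open_at_one" (is "?L \<longleftrightarrow> ?R")
proof
  assume L: ?L
  then have bij: "inj_on (eval_map G T) (carrier G)" "eval_map G T ` carrier G = carrier (bidual_group G T)"
    by (auto simp: top_group_iso_def iso_def bij_betw_def)
  have "homeomorphic_map T (bidual_top G T) (eval_map G T)"
    using L by (simp add: top_group_iso_def)
  then show ?R
    using bij homeomorphic_imp_continuous_map homeomorphic_imp_open_map
      continuous_eval_map_iff open_eval_map_iff by blast
next
  assume R: ?R
  have "homeomorphic_map T (bidual_top G T) (eval_map G T)"
    using R continuous_eval_map_iff open_eval_map_iff
    by (intro bijective_open_imp_homeomorphic_map)
      (auto simp: topspace_eq dual_group_def[of "dual_group G T"])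
  then show ?L
    using R eval_map_hom by (auto simp: top_group_iso_def iso_def bij_betw_def)
qed

end

section \<open>Quotients by compact subgroups\<close>

text \<open>Squaring expands near 1: norm (w^2 - 1) = norm (w + 1) * norm (w - 1), and w within 1/2
  of 1 forces norm (w + 1) >= 3/2. The distance to 1 thus grows by a factor 3/2 at each squaring,
  and stays bounded by 1/2 only if it is 0.\<close>

lemma circle_no_small_powers:
  fixes z :: complex
  assumes "norm z = 1" and small: "\<And>n. norm (z ^ n - 1) \<le> 1/2"
  shows "z = 1"
proof (rule ccontr)
  assume "z \<noteq> 1"
  have "norm (z ^ (2 ^ j) - 1) \<ge> (3/2) ^ j * norm (z - 1)" for j
  proof (induction j)
    case (Suc j)
    define w where "w = z ^ (2 ^ j)"
    have "w + 1 = 2 - (1 - w)" by simp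
    then have "norm (w + 1) \<ge> norm (2 :: complex) - norm (1 - w)"
      by (metis norm_triangle_ineq2)
    then have w: "norm (w + 1) \<ge> 3/2"
      using small[of "2 ^ j"] by (simp add: w_def norm_minus_commute)
    have "(3/2) ^ Suc j * norm (z - 1) \<le> (3/2) * norm (w - 1)" using Suc by (simp add: w_def mult.commute)
    also have "\<dots> \<le> norm (w + 1) * norm (w - 1)" using w by (intro mult_right_mono) auto
    also have "\<dots> = norm (z ^ (2 ^ Suc j) - 1)"
      by (simp add: w_def power_mult power2_eq_square algebra_simps flip: norm_mult)
    finally show ?case .
  qed simp
  then have *: "(3/2) ^ j * norm (z - 1) \<le> 1/2" for j
    using small order_trans by blast
  obtain j where "(1/2) / norm (z - 1) < (3/2 :: real) ^ j"
    using real_arch_pow[of "3/2"] by auto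
  then show False using *[of j] \<open>z \<noteq> 1\<close> by (simp add: field_simps)
qed

section \<open>The quotient map\<close>

text \<open>Joint continuity of the multiplication is used at two places: to show that the quotient
  map is closed, and to factor a neighbourhood of the identity in
  \<open>open_of_quotient_open\<close>.\<close>

locale compact_subgroup = semitopological_comm_group G T for G :: "'a monoid" (structure) and T +
  fixes K :: "'a set"
  assumes continuous_mult: "continuous_map (prod_topology T T) T (\<lambda>(x, y). x \<otimes> y)"
    and K_subgroup: "subgroup K G"
    and K_compact: "compactin T K"
begin

abbreviation "GK \<equiv> G Mod K"
abbreviation "TK \<equiv> quot_top G T K"

lemma K_carrier: "k \<in> K \<Longrightarrow> k \<in> carrier G"
  using K_subgroup subgroup.mem_carrier by metis

lemma K_normal: "K \<lhd> G"
  using K_subgroup by (simp add: normal_iff_subgroup)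

lemma coset_eq_iff:
  assumes "x \<in> carrier G" "y \<in> carrier G"
  shows "K #> x = K #> y \<longleftrightarrow> (\<exists>k\<in>K. y = k \<otimes> x)"
proof
  assume "K #> x = K #> y"
  then have "y \<in> K #> x" using assms repr_independenceD[OF K_subgroup] by blast
  then show "\<exists>k\<in>K. y = k \<otimes> x" by (auto simp: r_coset_def)
next
  assume "\<exists>k\<in>K. y = k \<otimes> x"
  then have "y \<in> K #> x" by (auto simp: r_coset_def)
  then show "K #> x = K #> y" using assms repr_independence[OF _ _ K_subgroup] by blast
qed

lemma coset_mult: "x \<in> carrier G \<Longrightarrow> y \<in> carrier G \<Longrightarrow> (K #> x) \<otimes>\<^bsub>GK\<^esub> (K #> y) = K #> (x \<otimes> y)"
  using normal.rcos_sum[OF K_normal] by simp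

lemma coset_carrier: "x \<in> carrier G \<Longrightarrow> K #> x \<in> carrier GK"
  by (auto simp: carrier_FactGroup)

lemma coset_one: "K #> \<one> = K"
  using coset_join2[OF one_closed K_subgroup] subgroup.one_closed[OF K_subgroup] by blast

lemma openin_quot_top:
  "openin TK U \<longleftrightarrow> U \<subseteq> carrier GK \<and> openin T {x \<in> carrier G. K #> x \<in> U}"
proof -
  have "istopology (\<lambda>U. U \<subseteq> carrier GK \<and> openin T {x \<in> topspace T. K #> x \<in> U})"
    unfolding istopology_def
  proof (intro conjI allI impI)
    fix U V assume "U \<subseteq> carrier GK \<and> openin T {x \<in> topspace T. K #> x \<in> U}"
      "V \<subseteq> carrier GK \<and> openin T {x \<in> topspace T. K #> x \<in> V}"
    then have "openin T ({x \<in> topspace T. K #> x \<in> U} \<inter> {x \<in> topspace T. K #> x \<in> V})" "U \<inter> V \<subseteq> carrier GK"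
      by auto
    moreover have "{x \<in> topspace T. K #> x \<in> U} \<inter> {x \<in> topspace T. K #> x \<in> V} = {x \<in> topspace T. K #> x \<in> U \<inter> V}"
      by auto
    ultimately show "U \<inter> V \<subseteq> carrier GK" "openin T {x \<in> topspace T. K #> x \<in> U \<inter> V}"
      by simp_all
  next
    fix \<U> assume U: "\<forall>U\<in>\<U>. U \<subseteq> carrier GK \<and> openin T {x \<in> topspace T. K #> x \<in> U}"
    then show "\<Union> \<U> \<subseteq> carrier GK" by blast
    have "openin T (\<Union>U\<in>\<U>. {x \<in> topspace T. K #> x \<in> U})" using U by auto
    moreover have "(\<Union>U\<in>\<U>. {x \<in> topspace T. K #> x \<in> U}) = {x \<in> topspace T. K #> x \<in> \<Union> \<U>}" by auto
    ultimately show "openin T {x \<in> topspace T. K #> x \<in> \<Union> \<U>}" by simp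
  qed
  then show ?thesis
    unfolding quot_top_def by (simp add: topology_inverse' topspace_eq)
qed

lemma topspace_quot_top: "topspace TK = carrier GK"
proof -
  have "{x \<in> carrier G. K #> x \<in> carrier GK} = topspace T"
    using coset_carrier by (auto simp: topspace_eq)
  then have "openin TK (carrier GK)" by (simp add: openin_quot_top)
  then show ?thesis
    using openin_quot_top[of "topspace TK"] openin_subset by blast
qed

lemma continuous_coset: "continuous_map T TK (\<lambda>x. K #> x)"
  unfolding continuous_map topspace_quot_top topspace_eq using coset_carrier openin_quot_top by auto

text \<open>The saturation of \<open>U\<close> is the union of its translates by elements of
  \<open>K\<close>.\<close>

lemma open_coset:
  assumes U: "openin T U"
  shows "openin TK ((\<lambda>x. K #> x) ` U)"
proof -
  have Us: "U \<subseteq> carrier G" using openin_subset[OF U] by (simp add: topspace_eq)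
  have "{x \<in> carrier G. K #> x \<in> (\<lambda>x. K #> x) ` U} = (\<Union>k\<in>K. {x \<in> carrier G. k \<otimes> x \<in> U})"
  proof (intro Set.set_eqI iffI)
    fix x assume "x \<in> {x \<in> carrier G. K #> x \<in> (\<lambda>x. K #> x) ` U}"
    then obtain u where u: "x \<in> carrier G" "u \<in> U" "K #> x = K #> u" by blast
    then obtain k where "k \<in> K" "u = k \<otimes> x" using coset_eq_iff[of x u] Us by blast
    then show "x \<in> (\<Union>k\<in>K. {x \<in> carrier G. k \<otimes> x \<in> U})" using u by blast
  next
    fix x assume "x \<in> (\<Union>k\<in>K. {x \<in> carrier G. k \<otimes> x \<in> U})"
    then obtain k where k: "k \<in> K" "x \<in> carrier G" "k \<otimes> x \<in> U" by blast
    then have "K #> x = K #> (k \<otimes> x)" using coset_eq_iff[of x "k \<otimes> x"] Us by blast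
    then show "x \<in> {x \<in> carrier G. K #> x \<in> (\<lambda>x. K #> x) ` U}" using k by blast
  qed
  moreover have "openin T (\<Union>k\<in>K. {x \<in> carrier G. k \<otimes> x \<in> U})"
    using openin_translate[OF U K_carrier] by auto
  ultimately show ?thesis
    unfolding openin_quot_top using Us coset_carrier by auto
qed

lemma quotient_semitopological: "semitopological_comm_group GK TK"
proof (intro semitopological_comm_group.intro semitopological_comm_group_axioms.intro
    abelian_FactGroup[OF K_subgroup] topspace_quot_top)
  interpret Q: comm_group GK by (rule abelian_FactGroup[OF K_subgroup])
  fix a' assume "a' \<in> carrier GK"
  then obtain a where a: "a \<in> carrier G" "a' = K #> a" by (auto simp: carrier_FactGroup)
  show "continuous_map TK TK (\<lambda>x. a' \<otimes>\<^bsub>GK\<^esub> x)"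
    unfolding continuous_map topspace_quot_top
  proof (intro conjI allI impI)
    show "(\<lambda>x. a' \<otimes>\<^bsub>GK\<^esub> x) ` carrier GK \<subseteq> carrier GK"
      using \<open>a' \<in> carrier GK\<close> by blast
    fix U assume "openin TK U"
    then have "openin T {x \<in> carrier G. K #> x \<in> U}" by (simp add: openin_quot_top)
    then have "openin T {x \<in> carrier G. a \<otimes> x \<in> {x \<in> carrier G. K #> x \<in> U}}"
      using openin_translate a by blast
    also have "{x \<in> carrier G. a \<otimes> x \<in> {x \<in> carrier G. K #> x \<in> U}} =
      {x \<in> carrier G. K #> x \<in> {y \<in> carrier GK. a' \<otimes>\<^bsub>GK\<^esub> y \<in> U}}"
      using a coset_carrier coset_mult[OF a(1)] by auto
    finally show "openin TK {x \<in> carrier GK. a' \<otimes>\<^bsub>GK\<^esub> x \<in> U}"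
      unfolding openin_quot_top by blast
  qed
qed

text \<open>Fibres are translates of \<open>K\<close>. The saturation of a closed \<open>F\<close>
  is the first projection of the closed set of pairs (x, k) with k in \<open>K\<close> and the
  product of x and k in \<open>F\<close>, and projecting along a compact factor is closed.
  Properness makes preimages of compact subsets of the quotient compact.\<close>

lemma coset_proper: "proper_map T TK (\<lambda>x. K #> x)"
  unfolding proper_map_def
proof (intro conjI ballI)
  fix y assume "y \<in> topspace TK"
  then obtain a where a: "a \<in> carrier G" "y = K #> a"
    unfolding topspace_quot_top by (auto simp: carrier_FactGroup)
  have "{x \<in> topspace T. K #> x = y} = (\<lambda>k. a \<otimes> k) ` K"
  proof (intro Set.set_eqI iffI)
    fix x assume "x \<in> {x \<in> topspace T. K #> x = y}"
    then have x: "x \<in> carrier G" "K #> a = K #> x" using a by (auto simp: topspace_eq)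
    then obtain k where "k \<in> K" "x = k \<otimes> a" using coset_eq_iff a(1) by blast
    then show "x \<in> (\<lambda>k. a \<otimes> k) ` K" using m_comm[OF a(1) K_carrier] by (metis image_eqI)
  next
    fix x assume "x \<in> (\<lambda>k. a \<otimes> k) ` K"
    then obtain k where k: "k \<in> K" "x = k \<otimes> a" using m_comm[OF a(1) K_carrier] by auto
    then have "x \<in> carrier G" "K #> a = K #> x" using coset_eq_iff[OF a(1), of x] a(1) K_carrier by auto
    then show "x \<in> {x \<in> topspace T. K #> x = y}" using a by (simp add: topspace_eq)
  qed
  then show "compactin T {x \<in> topspace T. K #> x = y}"
    using image_compactin[OF K_compact translation[OF a(1)]] by simp
next
  show "closed_map T TK (\<lambda>x. K #> x)"
    unfolding closed_map_def
  proof (intro allI impI)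
    fix F assume F: "closedin T F"
    have Fs: "F \<subseteq> carrier G" using closedin_subset[OF F] by (simp add: topspace_eq)
    let ?P = "prod_topology T (subtopology T K)"
    have Ks: "K \<subseteq> topspace T" using K_compact compactin_subset_topspace by blast
    have "continuous_map ?P T (\<lambda>(x, y). x \<otimes> y)"
    proof -
      have "?P = subtopology (prod_topology T T) (topspace T \<times> K)"
        by (metis prod_topology_subtopology(2))
      then show ?thesis using continuous_mult continuous_map_from_subtopology by metis
    qed
    then have "closedin ?P {p \<in> topspace ?P. (case p of (x, y) \<Rightarrow> x \<otimes> y) \<in> F}"
      using F by (rule closedin_continuous_map_preimage)
    moreover have "closed_map ?P T fst"
      using K_compact by (intro Abstract_Topological_Spaces.closed_map_fst) (simp add: compactin_subspace)
    ultimately have cl: "closedin T (fst ` {p \<in> topspace ?P. (case p of (x, y) \<Rightarrow> x \<otimes> y) \<in> F})"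
      by (auto simp: closed_map_def)
    have "carrier G - (fst ` {p \<in> topspace ?P. (case p of (x, y) \<Rightarrow> x \<otimes> y) \<in> F})
       = {x \<in> carrier G. K #> x \<in> carrier GK - (\<lambda>x. K #> x) ` F}"
    proof (intro Set.set_eqI iffI)
      fix x assume x: "x \<in> carrier G - (fst ` {p \<in> topspace ?P. (case p of (x, y) \<Rightarrow> x \<otimes> y) \<in> F})"
      have "K #> x \<notin> (\<lambda>x. K #> x) ` F"
      proof
        assume "K #> x \<in> (\<lambda>x. K #> x) ` F"
        then obtain f where f: "f \<in> F" "K #> x = K #> f" by blast
        then obtain k where k: "k \<in> K" "f = k \<otimes> x" using coset_eq_iff[of x f] x Fs by blast
        then have "x \<otimes> k \<in> F" using f m_comm[of x k] K_carrier x by auto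
        then have "(x, k) \<in> {p \<in> topspace ?P. (case p of (x, y) \<Rightarrow> x \<otimes> y) \<in> F}"
          using x k Ks by (auto simp: topspace_eq)
        then show False using x by force
      qed
      then show "x \<in> {x \<in> carrier G. K #> x \<in> carrier GK - (\<lambda>x. K #> x) ` F}"
        using x coset_carrier by blast
    next
      fix x assume x: "x \<in> {x \<in> carrier G. K #> x \<in> carrier GK - (\<lambda>x. K #> x) ` F}"
      have "x \<notin> fst ` {p \<in> topspace ?P. (case p of (x, y) \<Rightarrow> x \<otimes> y) \<in> F}"
      proof
        assume "x \<in> fst ` {p \<in> topspace ?P. (case p of (x, y) \<Rightarrow> x \<otimes> y) \<in> F}"
        then obtain k where k: "k \<in> K" "x \<otimes> k \<in> F" by auto
        then have "k \<otimes> x \<in> F" using m_comm[of x k] K_carrier x by auto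
        moreover have "K #> x = K #> (k \<otimes> x)" using coset_eq_iff[of x "k \<otimes> x"] x k(1) K_carrier by auto
        ultimately show False using x by blast
      qed
      then show "x \<in> carrier G - (fst ` {p \<in> topspace ?P. (case p of (x, y) \<Rightarrow> x \<otimes> y) \<in> F})"
        using x by blast
    qed
    moreover have "openin T (carrier G - (fst ` {p \<in> topspace ?P. (case p of (x, y) \<Rightarrow> x \<otimes> y) \<in> F}))"
      using cl by (simp add: closedin_def topspace_eq)
    ultimately have "openin TK (carrier GK - (\<lambda>x. K #> x) ` F)"
      by (simp add: openin_quot_top)
    then show "closedin TK ((\<lambda>x. K #> x) ` F)"
      using Fs coset_carrier by (auto simp: closedin_def topspace_quot_top)
  qed
qed

end

sublocale compact_subgroup \<subseteq> quotient: semitopological_comm_group "G Mod K" "quot_top G T K"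
  by (rule quotient_semitopological)

sublocale compact_subgroup \<subseteq> dual: semitopological_comm_group "dual_group G T" "dual_top G T"
  by (rule dual_semitopological)

section \<open>Characters of the quotient as the annihilator of the subgroup\<close>

context compact_subgroup
begin

definition annihilator :: "('a \<Rightarrow> complex) set" where
  "annihilator = {ch \<in> characters G T. \<forall>k\<in>K. ch k = 1}"

text \<open>The dual of the quotient homomorphism; it will identify the dual of the quotient with
  \<open>annihilator\<close>.\<close>

definition lift_char :: "('a set \<Rightarrow> complex) \<Rightarrow> 'a \<Rightarrow> complex" where
  "lift_char ch = (\<lambda>x\<in>carrier G. ch (K #> x))"

lemma lift_char_apply: "x \<in> carrier G \<Longrightarrow> lift_char ch x = ch (K #> x)"
  by (simp add: lift_char_def)

lemma annihilatorD: "ch \<in> annihilator \<Longrightarrow> ch \<in> characters G T"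
  by (simp add: annihilator_def)

lemma lift_char_annihilator:
  assumes ch: "ch \<in> characters GK TK"
  shows "lift_char ch \<in> annihilator"
proof -
  have "continuous_map T euclidean (ch \<circ> (\<lambda>x. K #> x))"
    by (rule continuous_map_compose[OF continuous_coset characters_continuous[OF ch]])
  then have "continuous_map T euclidean (lift_char ch)"
    by (rule continuous_map_eq) (simp add: topspace_eq lift_char_def)
  moreover have "lift_char ch \<in> alg_characters G"
    using characters_alg[OF ch] coset_carrier
    by (auto simp: alg_characters_iff lift_char_def coset_mult[symmetric] simp del: mult_FactGroup)
  moreover have "lift_char ch k = 1" if "k \<in> K" for k
  proof -
    have "K #> k = \<one>\<^bsub>GK\<^esub>" using coset_join2[OF K_carrier K_subgroup] that by simp
    then show ?thesis
      using quotient.character_at_one[OF ch] that K_carrier by (simp add: lift_char_def)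
  qed
  ultimately show ?thesis
    by (simp add: annihilator_def characters_eq[OF topspace_eq])
qed

lemma annihilator_lift_char:
  assumes ch: "ch \<in> annihilator"
  shows "\<exists>ps\<in>characters GK TK. lift_char ps = ch"
proof -
  have chT: "ch \<in> characters G T" using ch by (rule annihilatorD)
  \<comment> \<open>Any representative of the coset will do, since \<open>ch\<close> is constant on
    cosets of \<open>K\<close>.\<close>
  define ps where "ps = (\<lambda>C\<in>carrier GK. ch (SOME x. x \<in> C))"
  have ps: "ps (K #> x) = ch x" if x: "x \<in> carrier G" for x
  proof -
    have "x \<in> K #> x" using rcos_self[OF x K_subgroup] .
    then have "(SOME y. y \<in> K #> x) \<in> K #> x" by (rule someI)
    then obtain k where k: "k \<in> K" "(SOME y. y \<in> K #> x) = k \<otimes> x" by (auto simp: r_coset_def)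
    have "ch (k \<otimes> x) = ch k * ch x"
      using alg_characters_mult[OF characters_alg[OF chT] K_carrier[OF k(1)] x] .
    then show ?thesis using k ch x coset_carrier by (simp add: ps_def annihilator_def)
  qed
  have "ps \<in> alg_characters GK"
  proof -
    have "norm (ps y) = 1" if "y \<in> carrier GK" for y
      using that alg_characters_norm[OF characters_alg[OF chT]] by (auto simp: carrier_FactGroup ps)
    moreover have "ps (y \<otimes>\<^bsub>GK\<^esub> z) = ps y * ps z" if yz: "y \<in> carrier GK" "z \<in> carrier GK" for y z
    proof -
      obtain a b where "a \<in> carrier G" "b \<in> carrier G" "y = K #> a" "z = K #> b"
        using yz by (auto simp: carrier_FactGroup)
      then show ?thesis
        using alg_characters_mult[OF characters_alg[OF chT], of a b] by (simp add: coset_mult ps del: mult_FactGroup)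
    qed
    ultimately show ?thesis by (simp add: alg_characters_iff ps_def)
  qed
  moreover have "continuous_map TK euclidean ps"
    unfolding continuous_map topspace_quot_top
  proof (intro conjI allI impI)
    fix V :: "complex set" assume V: "openin euclidean V"
    have "openin T {x \<in> carrier G. ch x \<in> V}"
      using openin_continuous_map_preimage[OF characters_continuous[OF chT] V] by (simp add: topspace_eq)
    also have "{x \<in> carrier G. ch x \<in> V} = {x \<in> carrier G. K #> x \<in> {y \<in> carrier GK. ps y \<in> V}}"
      using ps coset_carrier by auto
    finally show "openin TK {y \<in> carrier GK. ps y \<in> V}" by (simp add: openin_quot_top subset_iff)
  qed simp
  ultimately have "ps \<in> characters GK TK" by (simp add: characters_eq[OF quotient.topspace_eq])
  moreover have "lift_char ps = ch"
    by (rule characters_extensionalityI[OF annihilatorD[OF lift_char_annihilator[OF calculation]] chT])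
      (simp add: lift_char_apply ps)
  ultimately show ?thesis by blast
qed

lemma lift_char_image: "lift_char ` characters GK TK = annihilator"
  using lift_char_annihilator annihilator_lift_char by blast

lemma lift_char_inj: "inj_on lift_char (characters GK TK)"
proof (rule inj_onI)
  fix f g assume fg: "f \<in> characters GK TK" "g \<in> characters GK TK" "lift_char f = lift_char g"
  show "f = g"
  proof (rule characters_extensionalityI[OF fg(1,2)])
    fix y assume "y \<in> carrier GK"
    then obtain x where "x \<in> carrier G" "y = K #> x" by (auto simp: carrier_FactGroup)
    then show "f y = g y" using lift_char_apply fg(3) by metis
  qed
qed

text \<open>The quotient of \<open>f\<close> by \<open>g\<close> sends \<open>K\<close> to a
  subgroup of the circle within 1/2 of 1. Powers of \<open>k\<close> stay in \<open>K\<close>, so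
  \<open>circle_no_small_powers\<close> forces that subgroup to be trivial.\<close>

lemma agree_on_K_if_close:
  assumes f: "f \<in> characters G T" and g: "g \<in> characters G T" and "\<And>k. k \<in> K \<Longrightarrow> dist (f k) (g k) < 1/2"
    and k: "k \<in> K"
  shows "f k = g k"
proof -
  have kG: "k \<in> carrier G" using k K_carrier by blast
  define z where "z = f k * cnj (g k)"
  have pw: "ch (k [^] n) = ch k ^ n" if "ch \<in> characters G T" for ch and n :: nat
    using that by (induction n) (auto simp: character_at_one alg_characters_mult[OF characters_alg] kG)
  have ng: "norm (g x) = 1" "norm (f x) = 1" if "x \<in> carrier G" for x
    using alg_characters_norm[OF characters_alg[OF g] that] alg_characters_norm[OF characters_alg[OF f] that]
    by simp_all
  have zz: "norm (f x * cnj (g x) - 1) = dist (f x) (g x)" if "x \<in> carrier G" for x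
  proof -
    have "f x * cnj (g x) - 1 = (f x - g x) * cnj (g x)"
      using cnj_mult_character[OF g that] by (simp add: algebra_simps)
    then show ?thesis using ng that by (simp add: norm_mult dist_norm)
  qed
  have "z = 1"
  proof (rule circle_no_small_powers)
    show "norm z = 1" using ng kG by (simp add: z_def norm_mult)
    fix n :: nat
    have kn: "k [^] n \<in> K"
      using k K_subgroup by (induction n) (auto simp: subgroup.one_closed subgroup.m_closed)
    have "z ^ n = f (k [^] n) * cnj (g (k [^] n))"
      by (simp add: z_def pw f g power_mult_distrib)
    then have "norm (z ^ n - 1) = dist (f (k [^] n)) (g (k [^] n))"
      using zz[of "k [^] n"] kG by simp
    also have "\<dots> < 1/2" using assms(3) kn by blast
    finally show "norm (z ^ n - 1) \<le> 1/2" by simp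
  qed
  then have "f k * (cnj (g k) * g k) = g k" unfolding z_def by (simp add: mult.assoc[symmetric])
  then show ?thesis using cnj_mult_character[OF g kG] by simp
qed

text \<open>This set is the coset of \<open>f\<close> modulo \<open>annihilator\<close>. With each
  character it contains all those within 1/2 of it on the compact set \<open>K\<close>.\<close>

lemma openin_agree_on_K:
  assumes f: "f \<in> characters G T"
  shows "openin (dual_top G T) {ch \<in> characters G T. \<forall>k\<in>K. ch k = f k}"
  unfolding openin_dual_top
proof (intro conjI ballI)
  fix ch assume ch: "ch \<in> {ch \<in> characters G T. \<forall>k\<in>K. ch k = f k}"
  have "ps \<in> {ch \<in> characters G T. \<forall>k\<in>K. ch k = f k}"
    if "ps \<in> characters G T" "\<forall>x\<in>K. dist (ps x) (ch x) < 1/2" for ps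
    using agree_on_K_if_close[of ps ch] that ch by auto
  then show "\<exists>C e. compactin T C \<and> e > 0 \<and> (\<forall>ps\<in>characters G T. (\<forall>x\<in>C. dist (ps x) (ch x) < e) \<longrightarrow>
      ps \<in> {ch \<in> characters G T. \<forall>k\<in>K. ch k = f k})"
    using K_compact by (intro exI[of _ K] exI[of _ "1/2"]) auto
qed auto

lemma continuous_lift_char: "continuous_map (dual_top GK TK) (dual_top G T) lift_char"
  unfolding continuous_map
proof (intro conjI allI impI)
  show "lift_char ` topspace (dual_top GK TK) \<subseteq> topspace (dual_top G T)"
    using lift_char_annihilator annihilatorD by auto
  fix W assume W: "openin (dual_top G T) W"
  show "openin (dual_top GK TK) {x \<in> topspace (dual_top GK TK). lift_char x \<in> W}"
    unfolding openin_dual_top[of GK]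
  proof (intro conjI ballI)
    fix ch assume ch: "ch \<in> {x \<in> topspace (dual_top GK TK). lift_char x \<in> W}"
    then obtain C e where C: "compactin T C" "e > 0"
      "\<forall>ps\<in>characters G T. (\<forall>x\<in>C. dist (ps x) (lift_char ch x) < e) \<longrightarrow> ps \<in> W"
      using W unfolding openin_dual_top by blast
    have Cs: "C \<subseteq> carrier G" using compactin_subset_topspace[OF C(1)] by (simp add: topspace_eq)
    have "lift_char ps \<in> W" if ps: "ps \<in> characters GK TK"
      "\<forall>y\<in>(\<lambda>x. K #> x) ` C. dist (ps y) (ch y) < e" for ps
    proof -
      have "dist (lift_char ps x) (lift_char ch x) < e" if "x \<in> C" for x
      proof -
        have "x \<in> carrier G" using that Cs by blast
        then show ?thesis using ps(2) that by (simp add: lift_char_apply)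
      qed
      then show ?thesis using C(3) annihilatorD[OF lift_char_annihilator[OF ps(1)]] by blast
    qed
    then show "\<exists>C e. compactin TK C \<and> e > 0 \<and> (\<forall>ps\<in>characters GK TK.
        (\<forall>x\<in>C. dist (ps x) (ch x) < e) \<longrightarrow> ps \<in> {x \<in> topspace (dual_top GK TK). lift_char x \<in> W})"
      using image_compactin[OF C(1) continuous_coset] C(2)
      by (intro exI[of _ "(\<lambda>x. K #> x) ` C"] exI[of _ e]) auto
  qed auto
qed

lemma open_lift_char: "open_map (dual_top GK TK) (dual_top G T) lift_char"
  unfolding open_map_def
proof (intro allI impI)
  fix W assume W: "openin (dual_top GK TK) W"
  then have Ws: "W \<subseteq> characters GK TK" using openin_subset by fastforce
  show "openin (dual_top G T) (lift_char ` W)"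
    unfolding openin_dual_top
  proof (intro conjI ballI)
    show "lift_char ` W \<subseteq> characters G T"
      using Ws lift_char_annihilator annihilatorD by blast
    fix f assume "f \<in> lift_char ` W"
    then obtain ch where ch: "ch \<in> W" "f = lift_char ch" by blast
    then obtain C e where C: "compactin TK C" "e > 0"
      "\<forall>ps\<in>characters GK TK. (\<forall>x\<in>C. dist (ps x) (ch x) < e) \<longrightarrow> ps \<in> W"
      using W unfolding openin_dual_top by blast
    have Cs: "C \<subseteq> carrier GK" using compactin_subset_topspace[OF C(1)] by (simp add: topspace_quot_top)
    \<comment> \<open>The preimage of \<open>C\<close> controls distances on \<open>C\<close>.
      Adding \<open>K\<close>, with tolerance 1/2, forces \<open>ps\<close> to agree with
      \<open>f\<close> on \<open>K\<close>, hence to descend to the quotient.\<close>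
    define B where "B = {x \<in> topspace T. K #> x \<in> C} \<union> K"
    have B: "compactin T B"
      unfolding B_def by (intro compactin_Un compactin_proper_map_preimage[OF coset_proper C(1)] K_compact)
    have fa: "f \<in> annihilator" using ch Ws lift_char_annihilator by blast
    have "ps \<in> lift_char ` W"
      if ps: "ps \<in> characters G T" "\<forall>x\<in>B. dist (ps x) (f x) < min e (1/2)" for ps
    proof -
      have "ps k = f k" if "k \<in> K" for k
        using ps(2) that by (intro agree_on_K_if_close[OF ps(1) annihilatorD[OF fa]]) (auto simp: B_def)
      then have "ps \<in> annihilator" using fa ps(1) by (simp add: annihilator_def)
      then obtain q where q: "q \<in> characters GK TK" "lift_char q = ps" using annihilator_lift_char by blast
      have "dist (q y) (ch y) < e" if y: "y \<in> C" for y
      proof -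
        obtain x where x: "x \<in> carrier G" "y = K #> x" using y Cs by (auto simp: carrier_FactGroup)
        then have "x \<in> B" using y by (simp add: B_def topspace_eq)
        then have "dist (ps x) (f x) < e" using ps(2) by auto
        then show ?thesis using x q(2) ch(2) by (auto simp: lift_char_apply)
      qed
      then have "q \<in> W" using C(3) q(1) by blast
      then show ?thesis using q(2) by blast
    qed
    then show "\<exists>C e. compactin T C \<and> e > 0 \<and>
        (\<forall>ps\<in>characters G T. (\<forall>x\<in>C. dist (ps x) (f x) < e) \<longrightarrow> ps \<in> lift_char ` W)"
      using B C(2) by (intro exI[of _ B] exI[of _ "min e (1/2)"]) auto
  qed
qed

lemma lift_char_homeomorphic:
  "homeomorphic_map (dual_top GK TK) (subtopology (dual_top G T) annihilator) lift_char"
  using injective_open_imp_embedding_map[OF continuous_lift_char open_lift_char] lift_char_inj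
  by (simp add: embedding_map_def lift_char_image)

lemma compactin_lift_char:
  assumes "C \<subseteq> characters GK TK"
  shows "compactin (dual_top G T) (lift_char ` C) \<longleftrightarrow> compactin (dual_top GK TK) C"
  using homeomorphic_map_compactness[OF lift_char_homeomorphic, of C] assms lift_char_image
  by (auto simp: compactin_subtopology)

text \<open>The cosets of \<open>annihilator\<close> are open, so finitely many cover
  \<open>D\<close>; they are also closed, so each meets \<open>D\<close> in a compact set, and
  dividing by a representative moves this set into \<open>annihilator\<close>.\<close>

lemma compactin_dual_decompose:
  assumes D: "compactin (dual_top G T) D"
  shows "\<exists>F C. finite F \<and> F \<subseteq> characters G T \<and> compactin (dual_top G T) C \<and> C \<subseteq> annihilator \<and>
    (\<forall>d\<in>D. \<exists>f\<in>F. \<exists>c\<in>C. \<forall>x\<in>carrier G. d x = f x * c x)"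
proof -
  have Ds: "D \<subseteq> characters G T" by (rule compactin_dual_subset[OF D])
  define N where "N f = {ch \<in> characters G T. \<forall>k\<in>K. ch k = f k}" for f :: "'a \<Rightarrow> complex"
  have N: "openin (dual_top G T) (N f)" if "f \<in> characters G T" for f
    unfolding N_def by (rule openin_agree_on_K[OF that])
  have "D \<subseteq> \<Union> (N ` D)" using Ds by (auto simp: N_def)
  moreover have "openin (dual_top G T) V" if "V \<in> N ` D" for V using that N Ds by blast
  ultimately have "\<exists>\<F>. finite \<F> \<and> \<F> \<subseteq> N ` D \<and> D \<subseteq> \<Union> \<F>"
    by (intro compactinD[OF D])
  then obtain \<F> where FF: "finite \<F>" "\<F> \<subseteq> N ` D" "D \<subseteq> \<Union> \<F>" by blast
  obtain F where F: "F \<subseteq> D" "finite F" "\<F> = N ` F"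
    using finite_subset_image[OF FF(1,2)] by blast
  have cov: "D \<subseteq> \<Union> (N ` F)" using FF F by simp
  have Fs: "F \<subseteq> characters G T" using F(1) Ds by blast
  \<comment> \<open>The complement of a coset is the union of the other cosets.\<close>
  have clN: "closedin (dual_top G T) (N f)" if "f \<in> characters G T" for f
  proof -
    have "openin (dual_top G T) (\<Union> (N ` (characters G T - N f)))" using N by auto
    moreover have "\<Union> (N ` (characters G T - N f)) = characters G T - N f"
      by (auto simp: N_def)
    moreover have "N f \<subseteq> characters G T" by (auto simp: N_def)
    ultimately show ?thesis by (simp add: closedin_def)
  qed
  define t where "t f = (\<lambda>ch. (\<lambda>x\<in>carrier G. cnj (f x)) \<otimes>\<^bsub>dual_group G T\<^esub> ch)" for f :: "'a \<Rightarrow> complex"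
  have t: "t f ch x = cnj (f x) * ch x" if "x \<in> carrier G" for f ch x
    using that by (simp add: t_def dual_group_def)
  define C where "C = (\<Union>f\<in>F. t f ` (N f \<inter> D))"
  have "compactin (dual_top G T) (t f ` (N f \<inter> D))" if "f \<in> F" for f
  proof (rule image_compactin)
    show "compactin (dual_top G T) (N f \<inter> D)" using clN Fs that D by (intro closed_Int_compactin) auto
    show "continuous_map (dual_top G T) (dual_top G T) (t f)"
      unfolding t_def using cnj_in_characters[of f] Fs that by (intro dual.translation) (auto simp: dual_group_def)
  qed
  then have "compactin (dual_top G T) C"
    unfolding C_def using F(2) by (intro compactin_Union) auto
  moreover have "C \<subseteq> annihilator"
  proof
    fix c assume "c \<in> C"
    then obtain f ch where fc: "f \<in> F" "ch \<in> N f" "c = t f ch" unfolding C_def by blast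
    have f: "f \<in> characters G T" using fc Fs by blast
    have "c \<in> characters G T"
      using fc mult_in_characters[OF cnj_in_characters[OF f], of ch] by (simp add: t_def dual_group_def N_def)
    moreover have "c k = 1" if "k \<in> K" for k
      using fc that K_carrier cnj_mult_character[OF f, of k] by (simp add: t N_def)
    ultimately show "c \<in> annihilator" by (simp add: annihilator_def)
  qed
  moreover have "\<exists>f\<in>F. \<exists>c\<in>C. \<forall>x\<in>carrier G. d x = f x * c x" if d: "d \<in> D" for d
  proof -
    obtain f where f: "f \<in> F" "d \<in> N f" using cov d by blast
    have "\<forall>x\<in>carrier G. d x = f x * t f d x"
    proof
      fix x assume x: "x \<in> carrier G"
      have "f x * t f d x = cnj (f x) * f x * d x" using x by (simp add: t)
      also have "\<dots> = d x" using cnj_mult_character[of f x] f(1) Fs x by auto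
      finally show "d x = f x * t f d x" by simp
    qed
    moreover have "t f d \<in> C" using f d unfolding C_def by blast
    ultimately show ?thesis using f(1) by blast
  qed
  ultimately show ?thesis using F(2) Fs by blast
qed

end

section \<open>Reflexivity of the quotient\<close>

text \<open>Compactness turns pointwise separation from 1 into separation by finitely many functions
  with one margin. It is applied to a compact set of homomorphisms in
  \<open>approximate_by_K\<close> and to a compact part of \<open>K\<close> in
  \<open>open_of_quotient_open\<close>.\<close>

lemma compactin_finite_separation:
  fixes f :: "'i \<Rightarrow> 'a \<Rightarrow> complex"
  assumes S: "compactin T S" and f: "\<And>i. i \<in> I \<Longrightarrow> continuous_map T euclidean (f i)"
    and sep: "\<And>s. s \<in> S \<Longrightarrow> \<exists>i\<in>I. f i s \<noteq> 1"
  shows "\<exists>F e. finite F \<and> F \<subseteq> I \<and> e > 0 \<and> (\<forall>s\<in>S. \<exists>i\<in>F. dist (f i s) 1 \<ge> e)"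
proof -
  define W where "W p = {s \<in> topspace T. f (fst p) s \<in> {z. dist z 1 > snd p}}" for p :: "'i \<times> real"
  define J where "J = I \<times> {e::real. e > 0}"
  have "openin T V" if V: "V \<in> W ` J" for V
  proof -
    obtain p where p: "p \<in> J" "V = W p" using V by blast
    have "open {z :: complex. dist z 1 > snd p}"
      by (intro open_Collect_less continuous_intros)
    then show ?thesis
      unfolding p(2) W_def using p(1) by (intro openin_continuous_map_preimage[OF f]) (auto simp: J_def)
  qed
  moreover have "S \<subseteq> \<Union> (W ` J)"
  proof
    fix s assume s: "s \<in> S"
    then obtain i where i: "i \<in> I" "f i s \<noteq> 1" using sep by blast
    \<comment> \<open>Half the distance makes the strict inequality in \<open>W\<close> hold at
      s.\<close>
    have "s \<in> W (i, dist (f i s) 1 / 2)"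
      using i s compactin_subset_topspace[OF S] by (auto simp: W_def)
    moreover have "(i, dist (f i s) 1 / 2) \<in> J" using i by (simp add: J_def)
    ultimately show "s \<in> \<Union> (W ` J)" by blast
  qed
  ultimately have "\<exists>\<F>. finite \<F> \<and> \<F> \<subseteq> W ` J \<and> S \<subseteq> \<Union> \<F>"
    by (intro compactinD[OF S])
  then obtain \<F> where FF: "finite \<F>" "\<F> \<subseteq> W ` J" "S \<subseteq> \<Union> \<F>" by blast
  obtain F where F: "F \<subseteq> J" "finite F" "\<F> = W ` F"
    using finite_subset_image[OF FF(1,2)] by blast
  \<comment> \<open>Inserting 1 keeps the minimum defined and positive even for empty
    \<open>F\<close>.\<close>
  define e where "e = Min (insert 1 (snd ` F))"
  have "e > 0" unfolding e_def using F by (subst Min_gr_iff) (auto simp: J_def)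
  moreover have "\<exists>i\<in>fst ` F. dist (f i s) 1 \<ge> e" if "s \<in> S" for s
  proof -
    obtain p where p: "p \<in> F" "s \<in> W p" using FF(3) F(3) \<open>s \<in> S\<close> by blast
    have "e \<le> snd p" unfolding e_def using F(2) p(1) by (intro Min_le) auto
    then have "dist (f (fst p) s) 1 \<ge> e" using p(2) by (simp add: W_def)
    then show ?thesis using p(1) by blast
  qed
  moreover have "finite (fst ` F)" "fst ` F \<subseteq> I" using F by (auto simp: J_def)
  ultimately show ?thesis by blast
qed

lemma dist_mult_one:
  fixes w z :: complex
  assumes "norm z = 1"
  shows "dist (w * z) 1 \<le> dist w 1 + dist z 1"
proof -
  have "dist (w * z) z = norm ((w - 1) * z)" by (simp add: dist_norm algebra_simps)
  then have "dist (w * z) z = dist w 1" using assms by (simp add: norm_mult dist_norm)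
  then show ?thesis using dist_triangle[of "w * z" 1 z] by simp
qed

context semitopological_comm_group
begin

lemma carrier_dual: "carrier (dual_group G T) = characters G T"
  by (simp add: dual_group_def)

lemma dual_mult_apply: "x \<in> carrier G \<Longrightarrow> (f \<otimes>\<^bsub>dual_group G T\<^esub> g) x = f x * g x"
  by (simp add: dual_group_def)

lemma dual_mult_closed: "f \<in> characters G T \<Longrightarrow> g \<in> characters G T \<Longrightarrow> f \<otimes>\<^bsub>dual_group G T\<^esub> g \<in> characters G T"
  by (simp add: dual_group_def mult_in_characters)

lemma eval_map_surj_iff:
  "eval_map G T ` carrier G = carrier (bidual_group G T) \<longleftrightarrow>
    (\<forall>P\<in>characters (dual_group G T) (dual_top G T). \<exists>a\<in>carrier G. \<forall>ch\<in>characters G T. P ch = ch a)"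
  (is "?L \<longleftrightarrow> ?R")
proof
  assume L: ?L
  show ?R
  proof
    fix P assume "P \<in> characters (dual_group G T) (dual_top G T)"
    then obtain a where "a \<in> carrier G" "P = eval_map G T a"
      using L by (auto simp: dual_group_def[of "dual_group G T"])
    then show "\<exists>a\<in>carrier G. \<forall>ch\<in>characters G T. P ch = ch a" by (auto simp: eval_map_apply)
  qed
next
  assume R: ?R
  show ?L
  proof (intro subset_antisym subsetI)
    fix P assume "P \<in> eval_map G T ` carrier G"
    then show "P \<in> carrier (bidual_group G T)"
      using eval_map_character by (auto simp: dual_group_def[of "dual_group G T"])
  next
    fix P assume "P \<in> carrier (bidual_group G T)"
    then have P: "P \<in> characters (dual_group G T) (dual_top G T)"
      by (simp add: dual_group_def[of "dual_group G T"])
    then obtain a where a: "a \<in> carrier G" "\<forall>ch\<in>characters G T. P ch = ch a" using R by blast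
    have "P = eval_map G T a"
      by (rule characters_extensionalityI[OF P eval_map_character[OF a(1)]])
        (use a(2) in \<open>simp add: eval_map_apply carrier_dual\<close>)
    then show "P \<in> eval_map G T ` carrier G" using a(1) by blast
  qed
qed

text \<open>Pointwise, \<open>eval_map\<close> is always continuous, whatever happens for the bidual
  topology. Hence the evaluations at points of \<open>K\<close> form a compact set.\<close>

lemma continuous_eval_map_pointwise: "continuous_map T euclidean (eval_map G T)"
proof -
  have "continuous_map T euclidean (\<lambda>a. eval_map G T a ch)" for ch
    by (cases "ch \<in> characters G T") (simp_all add: eval_map_def characters_continuous)
  then show ?thesis
    by (simp add: continuous_map_componentwise_UNIV flip: euclidean_product_topology)
qed

end

section \<open>Injectivity and surjectivity of evaluation\<close>

context compact_subgroup
begin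

text \<open>The characters killed by all evaluations at points of \<open>K\<close> are exactly those
  in \<open>annihilator\<close>. No continuity of \<open>P\<close> is asked, which matters in
  \<open>approximate_by_K\<close>, where \<open>P\<close> ranges over arbitrary
  homomorphisms.\<close>

lemma annihilator_trivial_imp_eval:
  assumes P: "P \<in> alg_characters (dual_group G T)" and triv: "\<And>ch. ch \<in> annihilator \<Longrightarrow> P ch = 1"
  shows "\<exists>k\<in>K. \<forall>ch\<in>characters G T. P ch = ch k"
proof -
  have mult: "ch (k \<otimes> l) = ch k * ch l" if "ch \<in> characters G T" "k \<in> K" "l \<in> K" for ch k l
    using alg_characters_mult[OF characters_alg[OF that(1)]] that(2,3) K_carrier by blast
  have inv: "ch (inv k) = cnj (ch k)" if "ch \<in> characters G T" "k \<in> K" for ch k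
    using alg_characters_inv[OF is_group characters_alg[OF that(1)]] that(2) K_carrier by blast
  have "P \<in> eval_map G T ` K"
  proof (rule compact_subgroup_double_annihilator[OF dual.is_group _ _ _ _ _ P])
    show "compact (eval_map G T ` K)"
      using image_compactin[OF K_compact continuous_eval_map_pointwise] by simp
    show "eval_map G T ` K \<subseteq> alg_characters (dual_group G T)"
      using eval_map_alg_character K_carrier by blast
    have "eval_map G T \<one> = (\<lambda>x\<in>carrier (dual_group G T). 1)"
      unfolding eval_map_def carrier_dual by (rule restrict_ext) (rule character_at_one)
    then show "(\<lambda>x\<in>carrier (dual_group G T). 1) \<in> eval_map G T ` K"
      using subgroup.one_closed[OF K_subgroup] by (metis image_eqI)
  next
    fix g h assume "g \<in> eval_map G T ` K" "h \<in> eval_map G T ` K"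
    then obtain k l where kl: "k \<in> K" "g = eval_map G T k" "l \<in> K" "h = eval_map G T l" by blast
    have "(\<lambda>x\<in>carrier (dual_group G T). g x * h x) = eval_map G T (k \<otimes> l)"
      unfolding eval_map_def[of _ _ "k \<otimes> l"] carrier_dual kl
      by (rule restrict_ext) (simp add: eval_map_apply mult kl)
    then show "(\<lambda>x\<in>carrier (dual_group G T). g x * h x) \<in> eval_map G T ` K"
      using subgroup.m_closed[OF K_subgroup kl(1,3)] by (metis image_eqI)
  next
    fix h assume "h \<in> eval_map G T ` K"
    then obtain k where k: "k \<in> K" "h = eval_map G T k" by blast
    have "(\<lambda>x\<in>carrier (dual_group G T). cnj (h x)) = eval_map G T (inv k)"
      unfolding eval_map_def[of _ _ "inv k"] carrier_dual k(2)
      by (rule restrict_ext) (simp add: eval_map_apply inv k)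
    then show "(\<lambda>x\<in>carrier (dual_group G T). cnj (h x)) \<in> eval_map G T ` K"
      using subgroup.m_inv_closed[OF K_subgroup k(1)] by (metis image_eqI)
  next
    fix ch assume ch: "ch \<in> carrier (dual_group G T)" "\<forall>h\<in>eval_map G T ` K. h ch = 1"
    then have "ch \<in> annihilator" by (auto simp: annihilator_def carrier_dual eval_map_apply)
    then show "P ch = 1" by (rule triv)
  qed
  then show ?thesis by (auto simp: eval_map_apply)
qed

text \<open>If the cosets of a and b are not separated, all of \<open>annihilator\<close> is trivial
  at c, the quotient of b by a. Evaluation at c is then evaluation at some k in \<open>K\<close>,
  and injectivity upstairs gives c = k.\<close>

lemma quotient_eval_map_inj:
  assumes inj: "inj_on (eval_map G T) (carrier G)"
  shows "inj_on (eval_map GK TK) (carrier GK)"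
proof (rule inj_onI)
  fix y z assume yz: "y \<in> carrier GK" "z \<in> carrier GK" "eval_map GK TK y = eval_map GK TK z"
  obtain a b where ab: "a \<in> carrier G" "y = K #> a" "b \<in> carrier G" "z = K #> b"
    using yz(1,2) by (auto simp: carrier_FactGroup)
  define c where "c = inv a \<otimes> b"
  have c: "c \<in> carrier G" using ab by (simp add: c_def)
  have "eval_map G T c ch = 1" if ch: "ch \<in> annihilator" for ch
  proof -
    obtain ps where ps: "ps \<in> characters GK TK" "lift_char ps = ch" using annihilator_lift_char[OF ch] by blast
    have "ps y = ps z" using yz(3) quotient.eval_map_apply[OF ps(1)] by metis
    then have "ch a = ch b" using ab ps(2) by (auto simp: lift_char_apply)
    moreover have "dist (ch c) 1 = dist (ch b) (ch a)"
      unfolding c_def using dist_character_translate[OF characters_alg[OF annihilatorD[OF ch]]] ab by blast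
    ultimately show ?thesis by (simp add: eval_map_apply annihilatorD[OF ch])
  qed
  then obtain k where k: "k \<in> K" "\<forall>ch\<in>characters G T. eval_map G T c ch = ch k"
    using annihilator_trivial_imp_eval[OF eval_map_alg_character[OF c]] by blast
  have "eval_map G T c = eval_map G T k"
    unfolding eval_map_def by (rule restrict_ext) (use k(2) in \<open>simp add: eval_map_apply\<close>)
  then have "c = k" using inj c K_carrier[OF k(1)] by (auto dest: inj_onD)
  then have "b = a \<otimes> k" using ab \<open>c = k\<close>[symmetric] by (simp add: c_def flip: m_assoc)
  then have "b = k \<otimes> a" using ab(1) K_carrier[OF k(1)] by (simp add: m_comm)
  then show "y = z" using ab k(1) coset_eq_iff[of a b] by blast
qed

lemma lift_char_mult:
  "lift_char (f \<otimes>\<^bsub>dual_group GK TK\<^esub> g) = lift_char f \<otimes>\<^bsub>dual_group G T\<^esub> lift_char g"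
  by (auto simp: lift_char_def dual_group_def coset_carrier intro!: restrict_ext)

lemma lift_char_character: "ch \<in> characters GK TK \<Longrightarrow> lift_char ch \<in> characters G T"
  using lift_char_annihilator annihilatorD by blast

lemma restrict_alg_character:
  assumes P: "P \<in> alg_characters (dual_group G T)"
  shows "(\<lambda>ch\<in>characters GK TK. P (lift_char ch)) \<in> alg_characters (dual_group GK TK)"
  unfolding alg_characters_iff quotient.carrier_dual
proof (intro conjI ballI)
  show "norm ((\<lambda>ch\<in>characters GK TK. P (lift_char ch)) ch) = 1" if "ch \<in> characters GK TK" for ch
    using alg_characters_norm[OF P, of "lift_char ch"] that by (simp add: carrier_dual lift_char_character)
  show "(\<lambda>ch\<in>characters GK TK. P (lift_char ch)) (f \<otimes>\<^bsub>dual_group GK TK\<^esub> g) =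
     (\<lambda>ch\<in>characters GK TK. P (lift_char ch)) f * (\<lambda>ch\<in>characters GK TK. P (lift_char ch)) g"
    if "f \<in> characters GK TK" "g \<in> characters GK TK" for f g
    using alg_characters_mult[OF P, of "lift_char f" "lift_char g"] that
    by (simp add: carrier_dual lift_char_character quotient.dual_mult_closed lift_char_mult)
qed auto

text \<open>The restrictions to the annihilator form a compact group of homomorphisms, and no
  nontrivial element is killed by all evaluations; so every homomorphism is a restriction.\<close>

lemma extend_alg_character:
  assumes P: "P \<in> alg_characters (dual_group GK TK)"
  shows "\<exists>Q\<in>alg_characters (dual_group G T). \<forall>ch\<in>characters GK TK. P ch = Q (lift_char ch)"
proof -
  define r where "r Q = (\<lambda>ch\<in>characters GK TK. Q (lift_char ch))" for Q :: "('a \<Rightarrow> complex) \<Rightarrow> complex"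
  let ?M = "alg_characters (dual_group G T)"
  have "P \<in> r ` ?M"
  proof (rule compact_subgroup_double_annihilator[OF comm_group.axioms(2)[OF quotient.dual_comm_group] _ _ _ _ _ P])
    have "continuous_on ?M (\<lambda>Q. r Q ch)" for ch
      unfolding r_def by (cases "ch \<in> characters GK TK") (simp_all add: continuous_on_coordinate)
    then have "continuous_on ?M r" by (rule continuous_on_coordinatewise_then_product)
    then show "compact (r ` ?M)" by (rule compact_continuous_image[OF _ compact_alg_characters])
    show "r ` ?M \<subseteq> alg_characters (dual_group GK TK)"
      using restrict_alg_character unfolding r_def by blast
    have "(\<lambda>ch\<in>characters G T. 1) \<in> ?M"
      by (auto simp: alg_characters_iff carrier_dual dual_mult_closed)
    moreover have "r (\<lambda>ch\<in>characters G T. 1) = (\<lambda>x\<in>carrier (dual_group GK TK). 1)"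
      unfolding r_def quotient.carrier_dual by (rule restrict_ext) (simp add: lift_char_character)
    ultimately show "(\<lambda>x\<in>carrier (dual_group GK TK). 1) \<in> r ` ?M" by (metis image_eqI)
  next
    fix g h assume "g \<in> r ` ?M" "h \<in> r ` ?M"
    then obtain p q where pq: "p \<in> ?M" "g = r p" "q \<in> ?M" "h = r q" by blast
    have "(\<lambda>ch\<in>characters G T. p ch * q ch) \<in> ?M"
      using pq(1,3) by (auto simp: alg_characters_iff carrier_dual dual_mult_closed norm_mult)
    moreover have "r (\<lambda>ch\<in>characters G T. p ch * q ch) = (\<lambda>x\<in>carrier (dual_group GK TK). g x * h x)"
      unfolding r_def quotient.carrier_dual pq by (rule restrict_ext) (simp add: lift_char_character)
    ultimately show "(\<lambda>x\<in>carrier (dual_group GK TK). g x * h x) \<in> r ` ?M" by (metis image_eqI)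
  next
    fix h assume "h \<in> r ` ?M"
    then obtain q where q: "q \<in> ?M" "h = r q" by blast
    have "(\<lambda>ch\<in>characters G T. cnj (q ch)) \<in> ?M"
      using q(1) by (auto simp: alg_characters_iff carrier_dual dual_mult_closed)
    moreover have "r (\<lambda>ch\<in>characters G T. cnj (q ch)) = (\<lambda>x\<in>carrier (dual_group GK TK). cnj (h x))"
      unfolding r_def quotient.carrier_dual q by (rule restrict_ext) (simp add: lift_char_character)
    ultimately show "(\<lambda>x\<in>carrier (dual_group GK TK). cnj (h x)) \<in> r ` ?M" by (metis image_eqI)
  next
    fix ch assume "ch \<in> carrier (dual_group GK TK)" and triv: "\<forall>h\<in>r ` ?M. h ch = 1"
    then have ch: "ch \<in> characters GK TK" by (simp add: quotient.carrier_dual)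
    have "ch y = 1" if y: "y \<in> carrier GK" for y
    proof -
      obtain a where a: "a \<in> carrier G" "y = K #> a" using y by (auto simp: carrier_FactGroup)
      have "r (eval_map G T a) ch = 1" using triv eval_map_alg_character[OF a(1)] by blast
      then show ?thesis using a ch by (simp add: r_def eval_map_apply lift_char_character lift_char_apply)
    qed
    then have "ch = \<one>\<^bsub>dual_group GK TK\<^esub>"
      by (intro characters_extensionalityI[OF ch]) (simp_all add: dual_group_def quotient.one_in_characters)
    then show "P ch = 1"
      using alg_characters_one[OF comm_group.axioms(2)[OF quotient.dual_comm_group] P] by simp
  qed
  then show ?thesis by (auto simp: r_def)
qed

text \<open>On \<open>annihilator\<close>, \<open>P\<close> is evaluation at the coset of some a.
  Dividing \<open>P\<close> by evaluation at a leaves a homomorphism trivial on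
  \<open>annihilator\<close>, that is, evaluation at some k in \<open>K\<close>; so \<open>P\<close>
  is evaluation at the product of a and k.\<close>

lemma surj_of_quotient_surj:
  assumes surj: "eval_map GK TK ` carrier GK = carrier (bidual_group GK TK)"
  shows "eval_map G T ` carrier G = carrier (bidual_group G T)"
  unfolding eval_map_surj_iff
proof
  fix P assume P: "P \<in> characters (dual_group G T) (dual_top G T)"
  define P' where "P' = (\<lambda>ch\<in>characters GK TK. P (lift_char ch))"
  have "continuous_map (dual_top GK TK) euclidean (P \<circ> lift_char)"
    by (rule continuous_map_compose[OF continuous_lift_char characters_continuous[OF P]])
  then have "continuous_map (dual_top GK TK) euclidean P'"
    by (rule continuous_map_eq) (simp add: P'_def)
  then have "P' \<in> characters (dual_group GK TK) (dual_top GK TK)"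
    using restrict_alg_character[OF characters_alg[OF P]]
    by (subst characters_eq) (simp_all add: P'_def quotient.carrier_dual)
  then obtain y where y: "y \<in> carrier GK" "\<forall>ch\<in>characters GK TK. P' ch = ch y"
    using surj unfolding quotient.eval_map_surj_iff by blast
  then obtain a where a: "a \<in> carrier G" "y = K #> a" by (auto simp: carrier_FactGroup)
  define Q where "Q = (\<lambda>ch\<in>characters G T. cnj (ch a) * P ch)"
  have "Q \<in> alg_characters (dual_group G T)"
    unfolding alg_characters_iff carrier_dual
  proof (intro conjI ballI)
    show "norm (Q f) = 1" if "f \<in> characters G T" for f
      using that alg_characters_norm[OF characters_alg[OF that] a(1)]
        alg_characters_norm[OF characters_alg[OF P], of f] by (simp add: Q_def norm_mult carrier_dual)
    show "Q (f \<otimes>\<^bsub>dual_group G T\<^esub> g) = Q f * Q g" if "f \<in> characters G T" "g \<in> characters G T" for f g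
      using that alg_characters_mult[OF characters_alg[OF P], of f g] a(1)
      by (simp add: Q_def carrier_dual dual_mult_closed dual_mult_apply)
  qed (simp add: Q_def)
  moreover have "Q ch = 1" if ch: "ch \<in> annihilator" for ch
  proof -
    obtain ps where ps: "ps \<in> characters GK TK" "lift_char ps = ch" using annihilator_lift_char[OF ch] by blast
    have "P ch = ch a" using y(2) ps a by (auto simp: P'_def lift_char_apply)
    then show ?thesis using cnj_mult_character[OF annihilatorD[OF ch] a(1)] annihilatorD[OF ch] by (simp add: Q_def)
  qed
  ultimately obtain k where k: "k \<in> K" "\<forall>ch\<in>characters G T. Q ch = ch k"
    using annihilator_trivial_imp_eval[of Q] by blast
  have "P ch = ch (a \<otimes> k)" if ch: "ch \<in> characters G T" for ch
  proof -
    have "ch (a \<otimes> k) = ch a * (cnj (ch a) * P ch)"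
      using k ch alg_characters_mult[OF characters_alg[OF ch] a(1) K_carrier[OF k(1)]] by (simp add: Q_def)
    also have "\<dots> = cnj (ch a) * ch a * P ch" by simp
    finally show ?thesis using cnj_mult_character[OF ch a(1)] by simp
  qed
  then show "\<exists>a\<in>carrier G. \<forall>ch\<in>characters G T. P ch = ch a"
    using a(1) K_carrier[OF k(1)] by blast
qed

lemma quotient_surj_of_surj:
  assumes surj: "eval_map G T ` carrier G = carrier (bidual_group G T)"
  shows "eval_map GK TK ` carrier GK = carrier (bidual_group GK TK)"
  unfolding quotient.eval_map_surj_iff
proof
  fix P assume P: "P \<in> characters (dual_group GK TK) (dual_top GK TK)"
  obtain Q where Q: "Q \<in> alg_characters (dual_group G T)" "\<forall>ch\<in>characters GK TK. P ch = Q (lift_char ch)"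
    using extend_alg_character[OF characters_alg[OF P]] by blast
  have "Q \<in> characters (dual_group G T) (dual_top G T)"
  proof (rule dual.character_if_continuous_at_one[OF Q(1)])
    fix e :: real assume e: "e > 0"
    let ?o = "\<one>\<^bsub>dual_group GK TK\<^esub>"
    have o: "?o \<in> characters GK TK" using quotient.one_in_characters by (simp add: dual_group_def)
    have Po: "P ?o = 1"
      using alg_characters_one[OF comm_group.axioms(2)[OF quotient.dual_comm_group] characters_alg[OF P]] .
    have "continuous_map (dual_top GK TK) euclidean P" by (rule characters_continuous[OF P])
    then obtain W where W: "openin (dual_top GK TK) W" "?o \<in> W" "\<forall>ch\<in>W. dist (P ch) (P ?o) < e"
      using o e unfolding continuous_map_euclidean_dist topspace_dual_top by meson
    have Ws: "W \<subseteq> characters GK TK" using openin_subset[OF W(1)] by simp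
    have "lift_char ?o = \<one>\<^bsub>dual_group G T\<^esub>"
      by (auto simp: lift_char_def dual_group_def coset_carrier intro!: restrict_ext)
    then have "\<one>\<^bsub>dual_group G T\<^esub> \<in> lift_char ` W" using W(2) by (metis image_eqI)
    \<comment> \<open>The image of \<open>W\<close> is a neighbourhood of the trivial character in
      the whole dual, and on it \<open>Q\<close> takes the values of \<open>P\<close>. This is where
      openness of \<open>annihilator\<close> makes the extension continuous.\<close>
    moreover have "openin (dual_top G T) (lift_char ` W)"
      using open_lift_char W(1) by (simp add: open_map_def)
    moreover have "\<forall>x\<in>lift_char ` W. dist (Q x) 1 < e"
    proof
      fix x assume "x \<in> lift_char ` W"
      then obtain ch where "ch \<in> W" "x = lift_char ch" by blast
      then show "dist (Q x) 1 < e" using W(3) Q(2) Ws Po by fastforce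
    qed
    ultimately show "\<exists>U. openin (dual_top G T) U \<and> \<one>\<^bsub>dual_group G T\<^esub> \<in> U \<and> (\<forall>x\<in>U. dist (Q x) 1 < e)"
      by blast
  qed
  then obtain a where a: "a \<in> carrier G" "\<forall>ch\<in>characters G T. Q ch = ch a"
    using surj unfolding eval_map_surj_iff by blast
  have "P ch = ch (K #> a)" if ch: "ch \<in> characters GK TK" for ch
    using Q(2) a ch lift_char_character[OF ch] by (simp add: lift_char_apply)
  then show "\<exists>y\<in>carrier GK. \<forall>ch\<in>characters GK TK. P ch = ch y"
    using coset_carrier[OF a(1)] by blast
qed

end

section \<open>Continuity and openness of evaluation\<close>

context compact_subgroup
begin

lemma annihilator_translate:
  assumes "ch \<in> annihilator" "k \<in> K" "a \<in> carrier G"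
  shows "ch (k \<otimes> a) = ch a"
  using assms alg_characters_mult[OF characters_alg[OF annihilatorD[OF assms(1)]] K_carrier[OF assms(2)] assms(3)]
  by (simp add: annihilator_def)

lemma compact_annihilator_lift:
  assumes C: "compactin (dual_top G T) C" "C \<subseteq> annihilator"
  obtains C' where "compactin (dual_top GK TK) C'" "C' \<subseteq> characters GK TK" "lift_char ` C' = C"
proof
  let ?C' = "{ch \<in> characters GK TK. lift_char ch \<in> C}"
  show "lift_char ` ?C' = C" using C(2) annihilator_lift_char by blast
  then show "compactin (dual_top GK TK) ?C'" using C(1) compactin_lift_char[of ?C'] by auto
qed auto

text \<open>Compact sets of characters of the quotient correspond to compact subsets of
  \<open>annihilator\<close>; neighbourhoods of the identity pass both ways, the quotient map being
  continuous and open.\<close>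

lemma quotient_continuous_at_one_iff:
  "quotient.eval_continuous_at_one \<longleftrightarrow>
    (\<forall>C e. compactin (dual_top G T) C \<longrightarrow> C \<subseteq> annihilator \<longrightarrow> e > 0 \<longrightarrow>
      (\<exists>U. openin T U \<and> \<one> \<in> U \<and> (\<forall>a\<in>U. \<forall>ch\<in>C. dist (ch a) 1 < e)))" (is "?L \<longleftrightarrow> ?R")
proof
  assume L: ?L
  show ?R
  proof (intro allI impI)
    fix C and e :: real assume C: "compactin (dual_top G T) C" "C \<subseteq> annihilator" and e: "e > 0"
    obtain C' where C': "compactin (dual_top GK TK) C'" "C' \<subseteq> characters GK TK" "lift_char ` C' = C"
      using compact_annihilator_lift[OF C] by blast
    obtain U where U: "openin TK U" "\<one>\<^bsub>GK\<^esub> \<in> U" "\<forall>y\<in>U. \<forall>ch\<in>C'. dist (ch y) 1 < e"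
      using L[unfolded quotient.eval_continuous_at_one_def] C'(1) e by blast
    have "openin T {x \<in> carrier G. K #> x \<in> U}" using U(1) by (simp add: openin_quot_top)
    moreover have "\<one> \<in> {x \<in> carrier G. K #> x \<in> U}" using U(2) by (simp add: coset_one)
    moreover have "dist (ch a) 1 < e" if a: "a \<in> {x \<in> carrier G. K #> x \<in> U}" and ch: "ch \<in> C" for a ch
    proof -
      obtain ps where ps: "ps \<in> C'" "ch = lift_char ps" using C'(3) ch by blast
      then show ?thesis using a U(3) by (simp add: lift_char_apply)
    qed
    ultimately show "\<exists>U. openin T U \<and> \<one> \<in> U \<and> (\<forall>a\<in>U. \<forall>ch\<in>C. dist (ch a) 1 < e)" by blast
  qed
next
  assume R: ?R
  show ?L
    unfolding quotient.eval_continuous_at_one_def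
  proof (intro allI impI)
    fix C and e :: real assume C: "compactin (dual_top GK TK) C" and e: "e > 0"
    have Cs: "C \<subseteq> characters GK TK" by (rule quotient.compactin_dual_subset[OF C])
    have lC: "compactin (dual_top G T) (lift_char ` C)" "lift_char ` C \<subseteq> annihilator"
      using compactin_lift_char[OF Cs] C Cs lift_char_annihilator by auto
    obtain U where U: "openin T U" "\<one> \<in> U" "\<forall>a\<in>U. \<forall>ch\<in>lift_char ` C. dist (ch a) 1 < e"
      using R[rule_format, OF lC e] by blast
    have Us: "U \<subseteq> carrier G" using openin_subset[OF U(1)] by (simp add: topspace_eq)
    have "\<one>\<^bsub>GK\<^esub> \<in> (\<lambda>x. K #> x) ` U" using U(2) coset_one by (metis image_eqI one_FactGroup)
    moreover have "dist (ch y) 1 < e" if y: "y \<in> (\<lambda>x. K #> x) ` U" and ch: "ch \<in> C" for y ch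
    proof -
      obtain x where x: "x \<in> U" "y = K #> x" using y by blast
      have "dist (lift_char ch x) 1 < e" using U(3) x(1) ch by blast
      then show ?thesis using x Us by (auto simp: lift_char_apply)
    qed
    ultimately show "\<exists>U. openin TK U \<and> \<one>\<^bsub>GK\<^esub> \<in> U \<and> (\<forall>a\<in>U. \<forall>ch\<in>C. dist (ch a) 1 < e)"
      using open_coset[OF U(1)] by blast
  qed
qed

text \<open>Under the same correspondence, a coset lies in the image of \<open>U\<close> when some
  element of \<open>K\<close> moves its representative into \<open>U\<close>. This k is the error
  that the openness proofs have to handle.\<close>

lemma quotient_open_at_one_iff:
  "quotient.eval_open_at_one \<longleftrightarrow>
    (\<forall>U. openin T U \<longrightarrow> \<one> \<in> U \<longrightarrow>
      (\<exists>C e. compactin (dual_top G T) C \<and> C \<subseteq> annihilator \<and> e > 0 \<and>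
        (\<forall>a\<in>carrier G. (\<forall>ch\<in>C. dist (ch a) 1 < e) \<longrightarrow> (\<exists>k\<in>K. k \<otimes> a \<in> U))))" (is "?L \<longleftrightarrow> ?R")
proof
  assume L: ?L
  show ?R
  proof (intro allI impI)
    fix U assume U: "openin T U" "\<one> \<in> U"
    have Us: "U \<subseteq> carrier G" using openin_subset[OF U(1)] by (simp add: topspace_eq)
    have "\<one>\<^bsub>GK\<^esub> \<in> (\<lambda>x. K #> x) ` U" using U(2) coset_one by (metis image_eqI one_FactGroup)
    then obtain C e where C: "compactin (dual_top GK TK) C" "e > 0"
      "\<forall>y\<in>carrier GK. (\<forall>ch\<in>C. dist (ch y) 1 < e) \<longrightarrow> y \<in> (\<lambda>x. K #> x) ` U"
      using L[unfolded quotient.eval_open_at_one_def, rule_format, OF open_coset[OF U(1)]] by blast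
    have Cs: "C \<subseteq> characters GK TK" by (rule quotient.compactin_dual_subset[OF C(1)])
    have "compactin (dual_top G T) (lift_char ` C)" using compactin_lift_char[OF Cs] C(1) by simp
    moreover have "lift_char ` C \<subseteq> annihilator" using Cs lift_char_annihilator by blast
    moreover have "\<exists>k\<in>K. k \<otimes> a \<in> U" if a: "a \<in> carrier G" "\<forall>ch\<in>lift_char ` C. dist (ch a) 1 < e" for a
    proof -
      have "\<forall>ch\<in>C. dist (ch (K #> a)) 1 < e" using a by (simp add: lift_char_apply)
      then have "K #> a \<in> (\<lambda>x. K #> x) ` U" using C(3) coset_carrier[OF a(1)] by blast
      then obtain u where u: "u \<in> U" "K #> a = K #> u" by blast
      then show ?thesis using coset_eq_iff[OF a(1), of u] Us by blast
    qed
    ultimately show "\<exists>C e. compactin (dual_top G T) C \<and> C \<subseteq> annihilator \<and> e > 0 \<and>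
        (\<forall>a\<in>carrier G. (\<forall>ch\<in>C. dist (ch a) 1 < e) \<longrightarrow> (\<exists>k\<in>K. k \<otimes> a \<in> U))"
      using C(2) by blast
  qed
next
  assume R: ?R
  show ?L
    unfolding quotient.eval_open_at_one_def
  proof (intro allI impI)
    fix U assume U: "openin TK U" "\<one>\<^bsub>GK\<^esub> \<in> U"
    have "openin T {x \<in> carrier G. K #> x \<in> U}" using U(1) by (simp add: openin_quot_top)
    moreover have "\<one> \<in> {x \<in> carrier G. K #> x \<in> U}" using U(2) by (simp add: coset_one)
    ultimately obtain C e where C: "compactin (dual_top G T) C" "C \<subseteq> annihilator" "e > 0"
      "\<forall>a\<in>carrier G. (\<forall>ch\<in>C. dist (ch a) 1 < e) \<longrightarrow> (\<exists>k\<in>K. k \<otimes> a \<in> {x \<in> carrier G. K #> x \<in> U})"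
      using R[rule_format, of "{x \<in> carrier G. K #> x \<in> U}"] by blast
    obtain C' where C': "compactin (dual_top GK TK) C'" "C' \<subseteq> characters GK TK" "lift_char ` C' = C"
      using compact_annihilator_lift[OF C(1,2)] by blast
    have "y \<in> U" if y: "y \<in> carrier GK" "\<forall>ch\<in>C'. dist (ch y) 1 < e" for y
    proof -
      obtain a where a: "a \<in> carrier G" "y = K #> a" using y(1) by (auto simp: carrier_FactGroup)
      have "\<forall>ch\<in>C. dist (ch a) 1 < e" using y(2) a by (auto simp: lift_char_apply simp flip: C'(3))
      then obtain k where k: "k \<in> K" "k \<otimes> a \<in> carrier G" "K #> (k \<otimes> a) \<in> U" using C(4) a(1) by blast
      have "K #> a = K #> (k \<otimes> a)" using coset_eq_iff[OF a(1) k(2)] k(1) by blast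
      then show ?thesis using a(2) k(3) by simp
    qed
    then show "\<exists>C e. compactin (dual_top GK TK) C \<and> e > 0 \<and>
       (\<forall>a\<in>carrier GK. (\<forall>ch\<in>C. dist (ch a) 1 < e) \<longrightarrow> a \<in> U)"
      using C'(1) C(3) by blast
  qed
qed

text \<open>A finitary version of the double annihilator theorem, obtained from compactness of the
  group of all homomorphisms from the dual to the circle.\<close>

lemma approximate_by_K:
  assumes F: "finite F" "F \<subseteq> characters G T" and d: "d > 0"
  shows "\<exists>E e. finite E \<and> E \<subseteq> annihilator \<and> e > 0 \<and>
    (\<forall>a\<in>carrier G. (\<forall>ch\<in>E. dist (ch a) 1 < e) \<longrightarrow> (\<exists>k\<in>K. \<forall>ch\<in>F. dist (ch (k \<otimes> a)) 1 < d))"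
proof -
  let ?M = "alg_characters (dual_group G T)"
  \<comment> \<open>The homomorphisms that, for every k in \<open>K\<close>, differ from evaluation
    at k by at least \<open>d\<close> somewhere on \<open>F\<close>. Finiteness of \<open>F\<close>
    makes this a closed condition.\<close>
  define N where "N = ?M \<inter> (\<Inter>k\<in>K. \<Union>x\<in>F. {P. d \<le> dist (P x) (x k)})"
  have "closed (\<Inter>k\<in>K. \<Union>x\<in>F. {P :: ('a \<Rightarrow> complex) \<Rightarrow> complex. d \<le> dist (P x) (x k)})"
    by (intro closed_INT ballI closed_UN F closed_Collect_le continuous_intros continuous_on_coordinate)
  then have "compact N" unfolding N_def by (rule compact_Int_closed[OF compact_alg_characters])
  then have cN: "compactin euclidean N" by simp
  \<comment> \<open>Were \<open>P\<close> trivial on \<open>annihilator\<close>, it would be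
    evaluation at some k, at distance 0 from itself.\<close>
  have "\<exists>y\<in>annihilator. P y \<noteq> 1" if P: "P \<in> N" for P
  proof (rule ccontr)
    assume "\<not> (\<exists>y\<in>annihilator. P y \<noteq> 1)"
    then obtain k where k: "k \<in> K" "\<forall>ch\<in>characters G T. P ch = ch k"
      using annihilator_trivial_imp_eval[of P] P unfolding N_def by blast
    then obtain x where "x \<in> F" "d \<le> dist (P x) (x k)" using P unfolding N_def by blast
    then show False using k(2) F(2) d by (auto simp: subset_iff)
  qed
  then obtain E e where E: "finite E" "E \<subseteq> annihilator" "e > 0" "\<forall>P\<in>N. \<exists>y\<in>E. dist (P y) 1 \<ge> e"
    using compactin_finite_separation[OF cN, of annihilator "\<lambda>y P. P y"] continuous_on_coordinate by auto
  have "\<exists>k\<in>K. \<forall>ch\<in>F. dist (ch (k \<otimes> a)) 1 < d"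
    if a: "a \<in> carrier G" "\<forall>ch\<in>E. dist (ch a) 1 < e" for a
  proof -
    have "eval_map G T a \<notin> N"
    proof
      assume "eval_map G T a \<in> N"
      then obtain y where y: "y \<in> E" "dist (eval_map G T a y) 1 \<ge> e" using E(4) by blast
      have "y \<in> characters G T" using y(1) E(2) annihilatorD by blast
      then show False using y a(2) by (auto simp: eval_map_apply)
    qed
    then obtain k where k: "k \<in> K" "\<forall>x\<in>F. \<not> d \<le> dist (eval_map G T a x) (x k)"
      unfolding N_def using eval_map_alg_character[OF a(1)] by blast
    \<comment> \<open>Here k approximates a on \<open>F\<close>, so the element of \<open>K\<close>
      that brings a close to the identity is the inverse of k.\<close>
    have "dist (x (inv k \<otimes> a)) 1 < d" if x: "x \<in> F" for x
    proof -
      have xc: "x \<in> characters G T" using x F(2) by blast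
      then show ?thesis
        using k(2) x dist_character_translate[OF characters_alg[OF xc] K_carrier[OF k(1)] a(1)]
        by (auto simp: eval_map_apply)
    qed
    then show ?thesis using subgroup.m_inv_closed[OF K_subgroup k(1)] by blast
  qed
  then show ?thesis using E(1-3) by blast
qed

text \<open>Each character in \<open>D\<close> is a product of one from a finite \<open>F\<close>
  and one from a compact \<open>C\<close> inside \<open>annihilator\<close>. Multiplying a by k in
  \<open>K\<close> leaves the values of \<open>C\<close> unchanged, so k can be chosen by
  \<open>approximate_by_K\<close> for \<open>F\<close> alone. Each factor may use half of
  \<open>d\<close>.\<close>

lemma quotient_open_of_open:
  assumes op: eval_open_at_one
  shows quotient.eval_open_at_one
  unfolding quotient_open_at_one_iff
proof (intro allI impI)
  fix U assume U: "openin T U" "\<one> \<in> U"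
  obtain D d where D: "compactin (dual_top G T) D" "d > 0"
    "\<forall>a\<in>carrier G. (\<forall>ch\<in>D. dist (ch a) 1 < d) \<longrightarrow> a \<in> U"
    using op[unfolded eval_open_at_one_def, rule_format, OF U] by blast
  obtain F C where F: "finite F" "F \<subseteq> characters G T"
    and C: "compactin (dual_top G T) C" "C \<subseteq> annihilator"
    and dec: "\<forall>ch\<in>D. \<exists>f\<in>F. \<exists>c\<in>C. \<forall>x\<in>carrier G. ch x = f x * c x"
    using compactin_dual_decompose[OF D(1)] by blast
  have d2: "d / 2 > 0" using D(2) by simp
  obtain E e where E: "finite E" "E \<subseteq> annihilator" "e > 0"
    "\<forall>a\<in>carrier G. (\<forall>ch\<in>E. dist (ch a) 1 < e) \<longrightarrow> (\<exists>k\<in>K. \<forall>ch\<in>F. dist (ch (k \<otimes> a)) 1 < d / 2)"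
    using approximate_by_K[OF F d2] by blast
  have "E \<subseteq> topspace (dual_top G T)" using E(2) annihilatorD by auto
  then have "compactin (dual_top G T) (C \<union> E)"
    using C(1) E(1) by (intro compactin_Un[OF _ finite_imp_compactin])
  moreover have "\<exists>k\<in>K. k \<otimes> a \<in> U"
    if a: "a \<in> carrier G" "\<forall>ch\<in>C \<union> E. dist (ch a) 1 < min e (d / 2)" for a
  proof -
    obtain k where k: "k \<in> K" "\<forall>ch\<in>F. dist (ch (k \<otimes> a)) 1 < d / 2"
      using E(4) a by auto
    have ka: "k \<otimes> a \<in> carrier G" using K_carrier[OF k(1)] a(1) by simp
    have "dist (ch (k \<otimes> a)) 1 < d" if "ch \<in> D" for ch
    proof -
      obtain f c where fc: "f \<in> F" "c \<in> C" "\<forall>x\<in>carrier G. ch x = f x * c x"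
        using bspec[OF dec \<open>ch \<in> D\<close>] by blast
      have c: "c \<in> annihilator" using fc(2) C(2) by blast
      have "dist (ch (k \<otimes> a)) 1 \<le> dist (f (k \<otimes> a)) 1 + dist (c (k \<otimes> a)) 1"
        using fc(3) ka dist_mult_one[OF alg_characters_norm[OF characters_alg[OF annihilatorD[OF c]] ka]] by simp
      moreover have "dist (c (k \<otimes> a)) 1 < d / 2"
        using annihilator_translate[OF c k(1) a(1)] a(2) fc(2) by simp
      ultimately show ?thesis using k(2) fc(1) by fastforce
    qed
    then have "k \<otimes> a \<in> U" using D(3) ka by blast
    then show ?thesis using k(1) by blast
  qed
  ultimately show "\<exists>C e. compactin (dual_top G T) C \<and> C \<subseteq> annihilator \<and> e > 0 \<and>
        (\<forall>a\<in>carrier G. (\<forall>ch\<in>C. dist (ch a) 1 < e) \<longrightarrow> (\<exists>k\<in>K. k \<otimes> a \<in> U))"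
    using C(2) E(2,3) D(2) by (intro exI[of _ "C \<union> E"] exI[of _ "min e (d / 2)"]) auto
qed

lemma openin_close_to_one:
  assumes F: "finite F" "F \<subseteq> characters G T" and e: "e > 0"
  shows "openin T {a \<in> carrier G. \<forall>f\<in>F. dist (f a) 1 < e}" "\<one> \<in> {a \<in> carrier G. \<forall>f\<in>F. dist (f a) 1 < e}"
proof -
  have "openin T {a \<in> topspace T. f a \<in> {z. dist z 1 < e}}" if "f \<in> F" for f
  proof (rule openin_continuous_map_preimage)
    show "continuous_map T euclidean f" using that F(2) characters_continuous by blast
    have "open {z :: complex. dist z 1 < e}" by (intro open_Collect_less continuous_intros)
    then show "openin euclidean {z :: complex. dist z 1 < e}" by simp
  qed
  then have "openin T (topspace T \<inter> (\<Inter>f\<in>F. {a \<in> topspace T. f a \<in> {z. dist z 1 < e}}))"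
    using F(1) by (cases "F = {}") (auto intro!: openin_Int openin_Inter)
  also have "topspace T \<inter> (\<Inter>f\<in>F. {a \<in> topspace T. f a \<in> {z. dist z 1 < e}})
      = {a \<in> carrier G. \<forall>f\<in>F. dist (f a) 1 < e}"
    by (auto simp: topspace_eq)
  finally show "openin T {a \<in> carrier G. \<forall>f\<in>F. dist (f a) 1 < e}" .
  show "\<one> \<in> {a \<in> carrier G. \<forall>f\<in>F. dist (f a) 1 < e}"
    using F(2) e by (auto simp: character_at_one subset_iff)
qed

text \<open>Compact subsets of \<open>annihilator\<close> are equicontinuous by hypothesis and
  finite sets of characters always are; every compact \<open>D\<close> lies in a product of one of
  each kind.\<close>

lemma continuous_of_quotient_continuous:
  assumes ct: quotient.eval_continuous_at_one
  shows eval_continuous_at_one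
  unfolding eval_continuous_at_one_def
proof (intro allI impI)
  fix D and e :: real assume D: "compactin (dual_top G T) D" and e: "e > 0"
  then have e2: "e / 2 > 0" by simp
  obtain F C where F: "finite F" "F \<subseteq> characters G T"
    and C: "compactin (dual_top G T) C" "C \<subseteq> annihilator"
    and dec: "\<forall>ch\<in>D. \<exists>f\<in>F. \<exists>c\<in>C. \<forall>x\<in>carrier G. ch x = f x * c x"
    using compactin_dual_decompose[OF D(1)] by blast
  obtain U where U: "openin T U" "\<one> \<in> U" "\<forall>a\<in>U. \<forall>ch\<in>C. dist (ch a) 1 < e / 2"
    using ct[unfolded quotient_continuous_at_one_iff, rule_format, OF C e2] by blast
  let ?V = "U \<inter> {a \<in> carrier G. \<forall>f\<in>F. dist (f a) 1 < e / 2}"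
  have "dist (ch a) 1 < e" if a: "a \<in> ?V" and "ch \<in> D" for a ch
  proof -
    obtain f c where fc: "f \<in> F" "c \<in> C" "\<forall>x\<in>carrier G. ch x = f x * c x"
      using bspec[OF dec \<open>ch \<in> D\<close>] by blast
    have c: "c \<in> annihilator" using fc(2) C(2) by blast
    have aG: "a \<in> carrier G" using a by blast
    have "dist (ch a) 1 \<le> dist (f a) 1 + dist (c a) 1"
      using fc(3) aG dist_mult_one[OF alg_characters_norm[OF characters_alg[OF annihilatorD[OF c]] aG]] by simp
    moreover have "dist (c a) 1 < e / 2" "dist (f a) 1 < e / 2" using a U(3) fc by auto
    ultimately show ?thesis by simp
  qed
  moreover have "openin T ?V" using U(1) openin_close_to_one(1)[OF F e2] by (rule openin_Int)
  moreover have "\<one> \<in> ?V" using U(2) openin_close_to_one(2)[OF F e2] by blast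
  ultimately show "\<exists>U. openin T U \<and> \<one> \<in> U \<and> (\<forall>a\<in>U. \<forall>ch\<in>D. dist (ch a) 1 < e)" by blast
qed

text \<open>The quotient only supplies k with k * a in a small set \<open>A\<close>. To conclude for
  a itself, the inverse of k must lie in \<open>B\<close>, where A * B is inside \<open>U\<close>.
  Injectivity gives finitely many characters bounded away from 1 on the part of \<open>K\<close>
  outside \<open>B\<close>; if they are near 1 at both a and k * a, they are near 1 at the inverse
  of k, which is therefore in \<open>B\<close>.\<close>

lemma open_of_quotient_open:
  assumes op: quotient.eval_open_at_one and inj: "inj_on (eval_map G T) (carrier G)"
  shows eval_open_at_one
  unfolding eval_open_at_one_def
proof (intro allI impI)
  fix U assume U: "openin T U" "\<one> \<in> U"
  have "openin (prod_topology T T) {p \<in> topspace (prod_topology T T). (case p of (x, y) \<Rightarrow> x \<otimes> y) \<in> U}"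
    by (rule openin_continuous_map_preimage[OF continuous_mult U(1)])
  moreover have "(\<one>, \<one>) \<in> {p \<in> topspace (prod_topology T T). (case p of (x, y) \<Rightarrow> x \<otimes> y) \<in> U}"
    using U(2) by (simp add: topspace_eq)
  ultimately obtain A B where AB: "openin T A" "openin T B" "\<one> \<in> A" "\<one> \<in> B"
    "A \<times> B \<subseteq> {p \<in> topspace (prod_topology T T). (case p of (x, y) \<Rightarrow> x \<otimes> y) \<in> U}"
    unfolding openin_prod_topology_alt by meson
  have "compactin T ((topspace T - B) \<inter> K)"
    using AB(2) K_compact by (intro closed_Int_compactin) auto
  moreover have "\<exists>ch\<in>characters G T. ch k \<noteq> 1" if k: "k \<in> (topspace T - B) \<inter> K" for k
  proof (rule ccontr)
    assume "\<not> (\<exists>ch\<in>characters G T. ch k \<noteq> 1)"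
    then have "eval_map G T k = eval_map G T \<one>"
      unfolding eval_map_def by (intro restrict_ext) (auto simp: character_at_one)
    then have "k = \<one>" using inj K_carrier k by (auto dest: inj_onD)
    then show False using k AB(4) by blast
  qed
  ultimately have "\<exists>F e. finite F \<and> F \<subseteq> characters G T \<and> e > 0 \<and>
      (\<forall>k\<in>(topspace T - B) \<inter> K. \<exists>ch\<in>F. dist (ch k) 1 \<ge> e)"
    by (intro compactin_finite_separation characters_continuous)
  then obtain F d where F: "finite F" "F \<subseteq> characters G T" and d: "d > 0"
    and sep: "\<forall>k\<in>(topspace T - B) \<inter> K. \<exists>ch\<in>F. dist (ch k) 1 \<ge> d"
    by blast
  have d2: "d / 2 > 0" using d by simp
  \<comment> \<open>Margin d/2 at k * a, from this set, and margin d/2 at a, from adding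
    \<open>F\<close> to \<open>C\<close>, together stay below the separation
    \<open>d\<close>.\<close>
  let ?V = "A \<inter> {a \<in> carrier G. \<forall>f\<in>F. dist (f a) 1 < d / 2}"
  have "openin T ?V" using AB(1) openin_close_to_one(1)[OF F d2] by (rule openin_Int)
  moreover have "\<one> \<in> ?V" using AB(3) openin_close_to_one(2)[OF F d2] by blast
  ultimately obtain C e where C: "compactin (dual_top G T) C" "C \<subseteq> annihilator" "e > 0"
    "\<forall>a\<in>carrier G. (\<forall>ch\<in>C. dist (ch a) 1 < e) \<longrightarrow> (\<exists>k\<in>K. k \<otimes> a \<in> ?V)"
    using op[unfolded quotient_open_at_one_iff, rule_format, of ?V] by blast
  have "compactin (dual_top G T) (C \<union> F)"
    using C(1) F by (intro compactin_Un[OF _ finite_imp_compactin]) auto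
  moreover have "a \<in> U" if a: "a \<in> carrier G" "\<forall>ch\<in>C \<union> F. dist (ch a) 1 < min e (d / 2)" for a
  proof -
    obtain k where k: "k \<in> K" "k \<otimes> a \<in> ?V" using C(4) a by auto
    define v where "v = k \<otimes> a"
    have v: "v \<in> carrier G" "v \<in> A" "\<forall>f\<in>F. dist (f v) 1 < d / 2" using k(2) by (auto simp: v_def)
    have kG: "k \<in> carrier G" by (rule K_carrier[OF k(1)])
    have av: "v \<otimes> inv k = a" 
      using kG a(1) by (simp add: v_def m_assoc m_comm[of k "a \<otimes> inv k"])
    have ik: "inv k = inv v \<otimes> a"
      unfolding av[symmetric] using v(1) kG by (simp flip: m_assoc)
    have "inv k \<in> B"
    proof (rule ccontr)
      assume "inv k \<notin> B"
      then have "inv k \<in> (topspace T - B) \<inter> K"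
        using subgroup.m_inv_closed[OF K_subgroup k(1)] kG by (simp add: topspace_eq)
      then obtain f where f: "f \<in> F" "dist (f (inv k)) 1 \<ge> d" using sep by blast
      have fc: "f \<in> characters G T" using f(1) F(2) by blast
      have "dist (f (inv k)) 1 = dist (f a) (f v)"
        unfolding ik by (rule dist_character_translate[OF characters_alg[OF fc] v(1) a(1)])
      also have "\<dots> \<le> dist (f a) 1 + dist (f v) 1" by (rule dist_triangle2)
      also have "\<dots> < d / 2 + d / 2" using a(2) v(3) f(1) by (intro add_strict_mono) auto
      finally show False using f(2) by simp
    qed
    then have "(v, inv k) \<in> A \<times> B" using v(2) by blast
    then have "v \<otimes> inv k \<in> U" using subsetD[OF AB(5)] by fastforce
    then show "a \<in> U" unfolding av .
  qed
  ultimately show "\<exists>C e. compactin (dual_top G T) C \<and> e > 0 \<and>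
      (\<forall>a\<in>carrier G. (\<forall>ch\<in>C. dist (ch a) 1 < e) \<longrightarrow> a \<in> U)"
    using C(3) d by (intro exI[of _ "C \<union> F"] exI[of _ "min e (d / 2)"]) auto
qed

lemma quotient_continuous_of_continuous:
  assumes eval_continuous_at_one
  shows quotient.eval_continuous_at_one
  using assms unfolding quotient_continuous_at_one_iff eval_continuous_at_one_def by blast

end

theorem mainTheorem19:
  fixes G :: "'a monoid" and T :: "'a topology" and K :: "'a set"
  assumes "abelian_topological_group G T"
    and "Hausdorff_space T"
    and "inj_on (eval_map G T) (carrier G)"
    and "subgroup K G"
    and "compactin T K"
  shows "inj_on (eval_map (G Mod K) (quot_top G T K)) (carrier (G Mod K))
    \<and> (eval_map (G Mod K) (quot_top G T K) ` carrier (G Mod K)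
            = carrier (bidual_group (G Mod K) (quot_top G T K))
         \<longleftrightarrow> eval_map G T ` carrier G = carrier (bidual_group G T))
    \<and> (top_group_iso (G Mod K) (quot_top G T K)
            (bidual_group (G Mod K) (quot_top G T K)) (bidual_top (G Mod K) (quot_top G T K))
            (eval_map (G Mod K) (quot_top G T K))
         \<longleftrightarrow> top_group_iso G T (bidual_group G T) (bidual_top G T) (eval_map G T))"
proof -
  have top: "topspace T = carrier G" and mult: "continuous_map (prod_topology T T) T (\<lambda>(x, y). x \<otimes>\<^bsub>G\<^esub> y)"
    using assms(1) by (auto simp: abelian_topological_group_def)
  interpret comm_group G using assms(1) by (simp add: abelian_topological_group_def)
  have "continuous_map T T (\<lambda>x. a \<otimes>\<^bsub>G\<^esub> x)" if "a \<in> carrier G" for a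
  proof -
    have "continuous_map T (prod_topology T T) (\<lambda>x. (a, x))"
      using that by (intro continuous_map_pairedI) (simp_all add: top)
    from continuous_map_compose[OF this mult] show ?thesis by (simp add: o_def)
  qed
  then interpret compact_subgroup G T K
    using top mult assms(4,5)
    by (intro compact_subgroup.intro semitopological_comm_group.intro comm_group_axioms
        semitopological_comm_group_axioms.intro compact_subgroup_axioms.intro)
  have inj: "inj_on (eval_map GK TK) (carrier GK)"
    by (rule quotient_eval_map_inj[OF assms(3)])
  have surj: "eval_map GK TK ` carrier GK = carrier (bidual_group GK TK) \<longleftrightarrow>
      eval_map G T ` carrier G = carrier (bidual_group G T)"
    using surj_of_quotient_surj quotient_surj_of_surj by blast
  have "quotient.eval_continuous_at_one \<longleftrightarrow> eval_continuous_at_one"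
    using quotient_continuous_of_continuous continuous_of_quotient_continuous by blast
  moreover have "quotient.eval_open_at_one \<longleftrightarrow> eval_open_at_one"
    using quotient_open_of_open open_of_quotient_open assms(3) by blast
  ultimately show ?thesis
    unfolding top_group_iso_eval_map_iff quotient.top_group_iso_eval_map_iff
    using inj surj assms(3) by blast
qed

end
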